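(* Let $n\ge2$, let $\Omega\subset\mathbb{R}^n$ be a bounded domain, let $\delta,\tau\in(0,1)$ and $n-\delta\le\beta\le n$. Then the following two conditions are equivalent. (1) For any $\gamma\in(0,1)$ there exists a constant $C>0$ independent of $\delta$ such that for every Lebesgue measurable set $U\subset\Omega$ with $|U|/|\Omega|\le\gamma$ one can find a set $\mathcal{N}_U$ of Lebesgue measure zero such that $$\mathcal{H}^\beta_\infty(U\setminus\mathcal{N}_U)\le C(1-\delta)\,\mathcal{P}_{\delta,\tau}(U,\Omega),$$ and, if $U$ is an open set, $\mathcal{H}^\beta_\infty(U)\le C(1-\delta)\,\mathcal{P}_{\delta,\tau}(U,\Omega)$. (2) There exists a constant $C>0$ independent of $\delta$ such that for every $f\in L^1(\Omega)$, $$\int_\Omega|f^*-f_\Omega|\,d\mathcal{H}^\beta_\infty\le C(1-\delta)\int_\Omega\int_{\{x\in\Omega:\,|x-y|<\tau d(y)\}}\frac{|f(x)-f(y)|}{|x-y|^{n+\delta}}\,dx\,dy.$$ Here "independent of $\delta$" means: for fixed $n,\Omega,\tau,\beta$ and any nonempty set $\Delta$ of $\delta\in(0,1)$ with $\delta\ge n-\beta$, condition (1) holds for all $\delta\in\Delta$ with $C$ (depending on $\gamma$) not depending on $\delta\in\Delta$ if and only if (2) holds for all $\delta\in\Delta$ with $C$ not depending on $\delta\in\Delta$.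
   Context: A domain is a nonempty open connected set; $d(x)=\operatorname{dist}(x,\partial\Omega)$; $f_\Omega=\frac1{|\Omega|}\int_\Omega f\,dx$. For measurable $U\subset\Omega$, $$\mathcal{P}_{\delta,\tau}(U,\Omega):=\int_\Omega\int_{\{x\in\Omega:\,|x-y|<\tau d(y)\}}\frac{|\chi_U(x)-\chi_U(y)|}{|x-y|^{n+\delta}}\,dx\,dy.$$ A point $x\in\Omega$ is a Lebesgue point of $f\in L^1(\Omega)$ if there is $a\in\mathbb{R}$ with $\lim_{r\to0}\frac{1}{|B(x,r)|}\int_{B(x,r)}|f(y)-a|\,dy=0$; $\mathcal{L}_f$ is the set of Lebesgue points and the precise representative $f^*:\mathcal{L}_f\to\mathbb{R}$ is $f^*(x):=a$. Integrals over $\Omega$ involving $f^*$ are understood over $\mathcal{L}_f$. Hausdorff content: $\mathcal{H}^\beta_\infty(A)=\inf\{\sum_i\omega_\beta r_i^\beta:A\subset\bigcup_iB(x_i,r_i)\}$ (countable coverings by balls), $\omega_\beta=\pi^{\beta/2}/\Gamma(\beta/2+1)$. Choquet integral: $\int_\Omega|g|\,d\mathcal{H}^\beta_\infty:=\int_0^\infty\mathcal{H}^\beta_\infty(\{x\in\Omega:|g(x)|>t\})\,dt$. *)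

theory Defs
  imports "HOL-Analysis.Analysis"
begin

text \<open>All energies, contents and Choquet integrals take values in \<open>[0,\<infinity>]\<close>. Functions on
  \<open>\<Omega>\<close> are total functions; their values outside \<open>\<Omega>\<close> do not matter.\<close>

definition bdry_dist :: "'a::euclidean_space set \<Rightarrow> 'a \<Rightarrow> real" where
  "bdry_dist \<Omega> x = infdist x (frontier \<Omega>)"

definition mean_value :: "'a::euclidean_space set \<Rightarrow> ('a \<Rightarrow> real) \<Rightarrow> real" where
  "mean_value \<Omega> f = (1 / measure lebesgue \<Omega>) * (LINT x:\<Omega>|lebesgue. f x)"

definition frac_energy ::
    "real \<Rightarrow> real \<Rightarrow> ('a::euclidean_space \<Rightarrow> real) \<Rightarrow> 'a set \<Rightarrow> ennreal" where
  "frac_energy \<delta> \<tau> f \<Omega> =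
     (\<integral>\<^sup>+ y\<in>\<Omega>. (\<integral>\<^sup>+ x\<in>{x\<in>\<Omega>. norm (x - y) < \<tau> * bdry_dist \<Omega> y}.
        ennreal (\<bar>f x - f y\<bar> / norm (x - y) powr (real DIM('a) + \<delta>)) \<partial>lebesgue) \<partial>lebesgue)"

definition frac_perimeter ::
    "real \<Rightarrow> real \<Rightarrow> 'a::euclidean_space set \<Rightarrow> 'a set \<Rightarrow> ennreal" where
  "frac_perimeter \<delta> \<tau> U \<Omega> = frac_energy \<delta> \<tau> (indicator U) \<Omega>"

definition is_lebesgue_value :: "('a::euclidean_space \<Rightarrow> real) \<Rightarrow> 'a \<Rightarrow> real \<Rightarrow> bool" where
  "is_lebesgue_value f x a \<longleftrightarrow>
     ((\<lambda>r. (1 / measure lebesgue (ball x r)) * (LINT y:ball x r|lebesgue. \<bar>f y - a\<bar>))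
        \<longlongrightarrow> 0) (at_right 0)"

text \<open>Since \<open>\<Omega>\<close> is open, only balls contained in \<open>\<Omega>\<close> matter for the limit at a point of \<open>\<Omega>\<close>.\<close>

definition lebesgue_points :: "'a::euclidean_space set \<Rightarrow> ('a \<Rightarrow> real) \<Rightarrow> 'a set" where
  "lebesgue_points \<Omega> f = {x\<in>\<Omega>. \<exists>a. is_lebesgue_value f x a}"

definition precise_rep :: "('a::euclidean_space \<Rightarrow> real) \<Rightarrow> 'a \<Rightarrow> real" where
  "precise_rep f x = (THE a. is_lebesgue_value f x a)"

text \<open>Radius \<open>0\<close> gives the empty open ball with cost \<open>0 powr \<beta> = 0\<close>, so sequences indexed by
  \<open>nat\<close> also represent finite coverings. The constant \<open>\<omega>\<^sub>\<beta>\<close> is the library's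
  \<open>unit_ball_vol \<beta> = pi powr (\<beta>/2) / Gamma (\<beta>/2 + 1)\<close>, defined for real \<open>\<beta>\<close>.\<close>

definition hausdorff_content :: "real \<Rightarrow> 'a::euclidean_space set \<Rightarrow> ennreal" where
  "hausdorff_content \<beta> A =
     Inf {(\<Sum>i. ennreal (unit_ball_vol \<beta> * r i powr \<beta>)) | (c :: nat \<Rightarrow> 'a) (r :: nat \<Rightarrow> real).
            (\<forall>i. 0 \<le> r i) \<and> A \<subseteq> (\<Union>i. ball (c i) (r i))}"

definition choquet_integral ::
    "real \<Rightarrow> 'a::euclidean_space set \<Rightarrow> ('a \<Rightarrow> real) \<Rightarrow> ennreal" where
  "choquet_integral \<beta> A g =
     (\<integral>\<^sup>+ t\<in>{0<..}. hausdorff_content \<beta> {x\<in>A. \<bar>g x\<bar> > t} \<partial>lborel)"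

end

theory Submission
  imports Defs
begin

text \<open>
  From (2) to (1), apply (2) to the indicator of \<open>U\<close>: its precise representative is \<open>1\<close> at every
  density point of \<open>U\<close>, while its mean is at most \<open>\<gamma>\<close>, and by Lebesgue's density theorem almost
  every point of \<open>U\<close> (every point, if \<open>U\<close> is open) is a density point.

  From (1) to (2), let \<open>m\<close> be a median of \<open>f\<close>. Where the precise representative exceeds \<open>m + t\<close>, the
  superlevel set \<open>U\<^sub>t = {f > m + t}\<close> has density one. Although null sets may have positive content,
  the content of the set of density points of \<open>U\<^sub>t\<close> is controlled by that of \<open>U\<^sub>t - N\<close> for any null
  set \<open>N\<close>, by a Vitali argument on an arbitrary covering of \<open>U\<^sub>t - N\<close>. Applying (1) with \<open>\<gamma> = 1/2\<close> to
  all \<open>U\<^sub>t\<close>, and to the sublevel sets, and integrating in \<open>t\<close> gives the estimate with \<open>m\<close> in place of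
  the mean, because the perimeters of the level sets integrate to at most the energy (coarea).
  Finally the difference between \<open>m\<close> and the mean is bounded by the \<open>L\<^sup>1\<close> distance of \<open>f\<close> to \<open>m\<close>,
  and Lebesgue measure on a bounded set is dominated by the content because \<open>\<beta> \<le> n\<close>.
\<close>

subsection \<open>Hausdorff content\<close>

lemma hausdorff_content_le:
  assumes "\<And>i. 0 \<le> r i" "A \<subseteq> (\<Union>i. ball (c i) (r i))"
  shows "hausdorff_content \<beta> A \<le> (\<Sum>i. ennreal (unit_ball_vol \<beta> * r i powr \<beta>))"
  unfolding hausdorff_content_def using assms by (intro Inf_lower) auto

lemma le_hausdorff_contentI:
  assumes "\<And>c r. \<lbrakk>\<And>i. 0 \<le> r i; A \<subseteq> (\<Union>i. ball (c i) (r i))\<rbrakk>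
    \<Longrightarrow> x \<le> (\<Sum>i. ennreal (unit_ball_vol \<beta> * r i powr \<beta>))"
  shows "x \<le> hausdorff_content \<beta> A"
  unfolding hausdorff_content_def using assms by (intro Inf_greatest) auto

text \<open>A constant factor passes through the infimum over coverings because
  \<open>ennreal K\<close> is invertible: it is neither 0 nor infinite, so the bound for each
  covering can first be multiplied by \<open>1/K\<close>.\<close>

lemma le_cmult_hausdorff_contentI:
  assumes K: "0 < K"
    and *: "\<And>c r. \<lbrakk>\<And>i. 0 \<le> r i; A \<subseteq> (\<Union>i. ball (c i) (r i))\<rbrakk>
      \<Longrightarrow> x \<le> ennreal K * (\<Sum>i. ennreal (unit_ball_vol \<beta> * r i powr \<beta>))"
  shows "x \<le> ennreal K * hausdorff_content \<beta> A"
proof -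
  have KK: "ennreal K * ennreal (1/K) = 1"
    using K by (simp flip: ennreal_mult)
  have "ennreal (1/K) * x \<le> hausdorff_content \<beta> A"
  proof (rule le_hausdorff_contentI)
    fix c and r :: "nat \<Rightarrow> real" assume "\<And>i. 0 \<le> r i" "A \<subseteq> (\<Union>i. ball (c i) (r i))"
    from *[OF this] have "ennreal (1/K) * x
        \<le> ennreal (1/K) * (ennreal K * (\<Sum>i. ennreal (unit_ball_vol \<beta> * r i powr \<beta>)))"
      by (rule mult_left_mono) simp
    also have "\<dots> = (\<Sum>i. ennreal (unit_ball_vol \<beta> * r i powr \<beta>))"
      using KK by (simp add: mult.assoc[symmetric] mult.commute)
    finally show "ennreal (1/K) * x \<le> (\<Sum>i. ennreal (unit_ball_vol \<beta> * r i powr \<beta>))" .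
  qed
  then have "ennreal K * (ennreal (1/K) * x) \<le> ennreal K * hausdorff_content \<beta> A"
    by (rule mult_left_mono) simp
  then show ?thesis
    using KK by (simp add: mult.assoc[symmetric])
qed

lemma hausdorff_content_mono:
  assumes "A \<subseteq> B"
  shows "hausdorff_content \<beta> A \<le> hausdorff_content \<beta> B"
  by (rule le_hausdorff_contentI, rule hausdorff_content_le) (use assms in auto)

lemma hausdorff_content_le_countable:
  fixes c :: "'b \<Rightarrow> 'a::euclidean_space"
  assumes I: "countable I" and r: "\<And>i. i \<in> I \<Longrightarrow> 0 \<le> r i" and A: "A \<subseteq> (\<Union>i\<in>I. ball (c i) (r i))"
  shows "hausdorff_content \<beta> A \<le> (\<integral>\<^sup>+i. ennreal (unit_ball_vol \<beta> * r i powr \<beta>) \<partial>count_space I)"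
proof -
  define J where "J = to_nat_on I ` I"
  define g where "g = from_nat_into I"
  have inj: "inj_on (to_nat_on I) I" using I by (rule inj_on_to_nat_on)
  have g: "g (to_nat_on I i) = i" if "i \<in> I" for i
    unfolding g_def using I that by (rule from_nat_into_to_nat_on)
  have bij: "bij_betw (to_nat_on I) I J"
    unfolding J_def using inj by (rule inj_on_imp_bij_betw)
  define w :: "real \<Rightarrow> ennreal" where "w s = ennreal (unit_ball_vol \<beta> * s powr \<beta>)" for s
  define s where "s n = (if n \<in> J then r (g n) else 0)" for n
  have "hausdorff_content \<beta> A \<le> (\<Sum>n. w (s n))"
    unfolding w_def
  proof (rule hausdorff_content_le)
    show "0 \<le> s n" for n using r g by (auto simp: s_def J_def)
    show "A \<subseteq> (\<Union>n. ball (c (g n)) (s n))"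
    proof
      fix x assume "x \<in> A"
      then obtain i where i: "i \<in> I" "x \<in> ball (c i) (r i)" using A by auto
      then have "x \<in> ball (c (g (to_nat_on I i))) (s (to_nat_on I i))"
        using g[OF i(1)] by (simp add: s_def J_def)
      then show "x \<in> (\<Union>n. ball (c (g n)) (s n))" by blast
    qed
  qed
  also have "\<dots> = (\<integral>\<^sup>+n. w (s n) \<partial>count_space UNIV)"
    by (simp add: nn_integral_count_space_nat)
  also have "\<dots> = (\<integral>\<^sup>+n. w (s n) \<partial>count_space J)"
    by (rule nn_integral_count_space_eq) (auto simp: s_def w_def)
  also have "\<dots> = (\<integral>\<^sup>+i. w (s (to_nat_on I i)) \<partial>count_space I)"
    by (rule nn_integral_bij_count_space[OF bij, symmetric])
  also have "\<dots> = (\<integral>\<^sup>+i. w (r i) \<partial>count_space I)"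
    by (rule nn_integral_cong) (auto simp: s_def J_def g)
  finally show ?thesis unfolding w_def .
qed

text \<open>The two sequences of balls are merged into one family over the disjoint sum
  \<open>nat + nat\<close>; its cost splits along \<open>Inl\<close> and \<open>Inr\<close>.\<close>

lemma hausdorff_content_Un_cover:
  fixes c d :: "nat \<Rightarrow> 'a::euclidean_space"
  assumes r: "\<And>i. 0 \<le> r i" and A: "A \<subseteq> (\<Union>i. ball (c i) (r i))"
    and s: "\<And>i. 0 \<le> s i" and B: "B \<subseteq> (\<Union>i. ball (d i) (s i))"
  shows "hausdorff_content \<beta> (A \<union> B) \<le> (\<Sum>i. ennreal (unit_ball_vol \<beta> * r i powr \<beta>))
    + (\<Sum>i. ennreal (unit_ball_vol \<beta> * s i powr \<beta>))"
proof -
  define w :: "real \<Rightarrow> ennreal" where "w s = ennreal (unit_ball_vol \<beta> * s powr \<beta>)" for s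
  have "0 \<le> case_sum r s i" for i using r s by (cases i) auto
  moreover have "A \<union> B \<subseteq> (\<Union>i\<in>UNIV. ball (case_sum c d i) (case_sum r s i))"
  proof
    fix x assume "x \<in> A \<union> B"
    then consider i where "x \<in> ball (c i) (r i)" | i where "x \<in> ball (d i) (s i)"
      using A B by blast
    then show "x \<in> (\<Union>i\<in>UNIV. ball (case_sum c d i) (case_sum r s i))"
    proof cases
      case (1 i)
      then show ?thesis by (intro UN_I[of "Inl i"]) auto
    next
      case (2 i)
      then show ?thesis by (intro UN_I[of "Inr i"]) auto
    qed
  qed
  ultimately have "hausdorff_content \<beta> (A \<union> B) \<le> (\<integral>\<^sup>+i. w (case_sum r s i) \<partial>count_space UNIV)"
    unfolding w_def by (intro hausdorff_content_le_countable) auto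
  also have "\<dots> = (\<integral>\<^sup>+i. w (case_sum r s i) * indicator (range Inl) i
      + w (case_sum r s i) * indicator (range Inr) i \<partial>count_space UNIV)"
    by (rule nn_integral_cong, split sum.split) (auto simp: indicator_def)
  also have "\<dots> = (\<integral>\<^sup>+i. w (case_sum r s i) \<partial>count_space (range Inl))
      + (\<integral>\<^sup>+i. w (case_sum r s i) \<partial>count_space (range Inr))"
    by (subst nn_integral_add) (auto simp: nn_integral_count_space_indicator)
  also have "(\<integral>\<^sup>+i. w (case_sum r s i) \<partial>count_space (range Inl)) = (\<Sum>i. w (r i))"
    by (subst nn_integral_bij_count_space[symmetric, of Inl UNIV])
      (auto simp: bij_betw_def nn_integral_count_space_nat)
  also have "(\<integral>\<^sup>+i. w (case_sum r s i) \<partial>count_space (range Inr)) = (\<Sum>i. w (s i))"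
    by (subst nn_integral_bij_count_space[symmetric, of Inr UNIV])
      (auto simp: bij_betw_def nn_integral_count_space_nat)
  finally show ?thesis unfolding w_def .
qed

text \<open>For finite \<open>y\<close> the summand is subtracted, the infimum is taken, and
  \<open>y\<close> is added back. The case \<open>y = top\<close> is separate because extended
  subtraction cancels only finite terms.\<close>

lemma le_hausdorff_content_addI:
  assumes *: "\<And>c r. \<lbrakk>\<And>i. 0 \<le> r i; A \<subseteq> (\<Union>i. ball (c i) (r i))\<rbrakk>
    \<Longrightarrow> x \<le> (\<Sum>i. ennreal (unit_ball_vol \<beta> * r i powr \<beta>)) + y"
  shows "x \<le> hausdorff_content \<beta> A + y"
proof (cases "y = top")
  case False
  have diff: "x - y \<le> a" if "x \<le> a + y" for a
    using ennreal_minus_mono[OF that order_refl, of y] False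
    by (simp add: ennreal_add_diff_cancel_right)
  have "x - y \<le> hausdorff_content \<beta> A"
    by (rule le_hausdorff_contentI, rule diff, rule *)
  then have "x - y + y \<le> hausdorff_content \<beta> A + y"
    by (rule add_right_mono)
  moreover have "x \<le> x - y + y"
    by (cases "y \<le> x") (auto simp: diff_add_cancel_ennreal add_increasing)
  ultimately show ?thesis by (rule order_trans[rotated])
qed simp

lemma hausdorff_content_Un_le:
  fixes A B :: "'a::euclidean_space set"
  shows "hausdorff_content \<beta> (A \<union> B) \<le> hausdorff_content \<beta> A + hausdorff_content \<beta> B"
proof (rule le_hausdorff_content_addI)
  fix c and r :: "nat \<Rightarrow> real"
  assume r: "\<And>i. 0 \<le> r i" "A \<subseteq> (\<Union>i. ball (c i) (r i))"
  have "hausdorff_content \<beta> (A \<union> B)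
    \<le> hausdorff_content \<beta> B + (\<Sum>i. ennreal (unit_ball_vol \<beta> * r i powr \<beta>))"
    \<comment> \<open>The covering of \<open>A\<close> is held fixed while the infimum over
      coverings of \<open>B\<close> is taken; the outer application of the same rule then frees the
      covering of \<open>A\<close>.\<close>
    by (rule le_hausdorff_content_addI, subst add.commute, rule hausdorff_content_Un_cover[OF r])
  then show "hausdorff_content \<beta> (A \<union> B)
    \<le> (\<Sum>i. ennreal (unit_ball_vol \<beta> * r i powr \<beta>)) + hausdorff_content \<beta> B"
    by (simp add: add.commute)
qed

lemma hausdorff_content_bounded_finite:
  fixes A :: "'a::euclidean_space set"
  assumes "bounded A"
  shows "hausdorff_content \<beta> A < \<infinity>"
proof -
  obtain R where R: "0 < R" "A \<subseteq> ball 0 R"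
    using bounded_subset_ballD[OF assms] by blast
  have "hausdorff_content \<beta> A \<le> (\<integral>\<^sup>+i. ennreal (unit_ball_vol \<beta> * R powr \<beta>) \<partial>count_space {0::nat})"
    by (rule hausdorff_content_le_countable[where c="\<lambda>_. 0"]) (use R in auto)
  also have "\<dots> < \<infinity>"
    by (simp add: nn_integral_count_space_finite)
  finally show ?thesis .
qed

section \<open>Comparison of volume with content\<close>

lemma emeasure_lebesgue_ball:
  fixes x :: "'a::euclidean_space"
  shows "0 \<le> r \<Longrightarrow> emeasure lebesgue (ball x r) = ennreal (unit_ball_vol (real DIM('a)) * r powr real DIM('a))"
  by (cases "r = 0") (auto simp: emeasure_ball powr_realpow)

text \<open>For radii at most 1, \<open>r powr n \<le> r powr \<beta>\<close>, so subadditivity of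
  volume gives the bound. A covering with a radius above 1 already costs a fixed positive amount,
  which is compared with the volume of the whole of \<open>\<Omega>\<close>. Volume does not see
  \<open>N\<close>, so the bound applies directly to the content of \<open>U - N\<close> supplied by
  condition (1).\<close>

lemma emeasure_le_hausdorff_content:
  fixes \<Omega> :: "'a::euclidean_space set" and \<beta> :: real
  assumes "bounded \<Omega>" "\<Omega> \<in> sets lebesgue" and \<beta>: "0 < \<beta>" "\<beta> \<le> DIM('a)"
  obtains K where "0 < K" "\<And>A N. \<lbrakk>A \<in> sets lebesgue; A \<subseteq> \<Omega>; N \<in> null_sets lebesgue\<rbrakk>
    \<Longrightarrow> emeasure lebesgue A \<le> ennreal K * hausdorff_content \<beta> (A - N)"
proof -
  let ?n = "real DIM('a)"
  \<comment> \<open>One constant for both cases: the unit ball volume handles small radii, the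
    volume of \<open>\<Omega>\<close> handles a radius above 1.\<close>
  define V where "V = unit_ball_vol ?n + measure lebesgue \<Omega>"
  define K where "K = V / unit_ball_vol \<beta>"
  have V: "0 < V"
    by (simp add: V_def add_pos_nonneg)
  have b: "0 < unit_ball_vol \<beta>" using \<beta> by simp
  have K: "0 < K" unfolding K_def using V b by simp
  have "\<Omega> \<in> lmeasurable" using assms by (simp add: bounded_set_imp_lmeasurable)
  then have em: "emeasure lebesgue \<Omega> = ennreal (measure lebesgue \<Omega>)"
    by (simp add: emeasure_eq_measure2)
  have "emeasure lebesgue A \<le> ennreal K * hausdorff_content \<beta> (A - N)"
    if A: "A \<in> sets lebesgue" "A \<subseteq> \<Omega>" and N: "N \<in> null_sets lebesgue" for A N
  proof (rule le_cmult_hausdorff_contentI[OF K])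
    fix c and r :: "nat \<Rightarrow> real"
    assume r: "\<And>i. 0 \<le> r i" and cov: "A - N \<subseteq> (\<Union>i. ball (c i) (r i))"
    have R: "ennreal K * (\<Sum>i. ennreal (unit_ball_vol \<beta> * r i powr \<beta>)) = (\<Sum>i. ennreal (V * r i powr \<beta>))"
      using K b by (simp add: K_def flip: ennreal_suminf_cmult ennreal_mult)
    show "emeasure lebesgue A \<le> ennreal K * (\<Sum>i. ennreal (unit_ball_vol \<beta> * r i powr \<beta>))"
    proof (cases "\<forall>i. r i \<le> 1")
      case True
      have "emeasure lebesgue A = emeasure lebesgue (A - N)"
        using A N by (simp add: emeasure_Diff_null_set)
      also have "\<dots> \<le> emeasure lebesgue (\<Union>i. ball (c i) (r i))"
        by (rule emeasure_mono[OF cov]) auto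
      also have "\<dots> \<le> (\<Sum>i. emeasure lebesgue (ball (c i) (r i)))"
        by (rule emeasure_subadditive_countably) auto
      also have "\<dots> \<le> (\<Sum>i. ennreal (V * r i powr \<beta>))"
      proof (rule suminf_le)
        fix i
        have "r i powr ?n \<le> r i powr \<beta>"
          using True r[of i] \<beta> powr_mono'[of \<beta> ?n "r i"] by auto
        then have "unit_ball_vol ?n * r i powr ?n \<le> V * r i powr \<beta>"
          by (intro mult_mono) (auto simp: V_def)
        then show "emeasure lebesgue (ball (c i) (r i)) \<le> ennreal (V * r i powr \<beta>)"
          using r by (simp add: emeasure_lebesgue_ball ennreal_leI del: emeasure_completion)
      qed auto
      finally show ?thesis unfolding R .
    next
      case False
      then obtain j where j: "1 < r j" by (meson not_le)
      have "emeasure lebesgue A \<le> emeasure lebesgue \<Omega>"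
        using A assms by (intro emeasure_mono) auto
      also have "\<dots> \<le> ennreal (V * r j powr \<beta>)"
      proof -
        have "1 \<le> r j powr \<beta>" using j \<beta> by (intro ge_one_powr_ge_zero) auto
        then have "V * 1 \<le> V * r j powr \<beta>" using V by (intro mult_left_mono) auto
        moreover have "measure lebesgue \<Omega> \<le> V" by (simp add: V_def)
        ultimately show ?thesis unfolding em by (intro ennreal_leI) simp
      qed
      also have "\<dots> \<le> (\<Sum>i. ennreal (V * r i powr \<beta>))"
        using sum_le_suminf[of "\<lambda>i. ennreal (V * r i powr \<beta>)" "{j}"] by simp
      finally show ?thesis unfolding R .
    qed
  qed
  with K that show ?thesis by blast
qed

text \<open>A covering of \<open>U - N\<close> may miss points of the density set, but it still
  covers at least half the volume of each ball in which \<open>U\<close> fills half. So each such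
  ball is either near a covering ball of at least its size or is half filled by smaller ones. The
  first kind contributes \<open>2 powr \<beta>\<close> by doubling; the second contributes
  \<open>2 * 10 powr \<beta>\<close>, from the half filling, the doubled balls and Vitali's factor
  5.\<close>

lemma hausdorff_content_density_set_le:
  fixes U :: "'a::euclidean_space set" and \<beta> :: real
  assumes U: "U \<in> sets lebesgue" and N: "N \<in> null_sets lebesgue" and \<beta>: "0 < \<beta>" "\<beta> \<le> DIM('a)"
  shows "hausdorff_content \<beta> {x. \<exists>r. 0 < r \<and> r \<le> 1
        \<and> emeasure lebesgue (ball x r) \<le> 2 * emeasure lebesgue (U \<inter> ball x r)}
    \<le> ennreal (2 powr \<beta> + 2 * 10 powr \<beta>) * hausdorff_content \<beta> (U - N)"
    (is "hausdorff_content \<beta> ?W \<le> _")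
proof (rule le_cmult_hausdorff_contentI)
  show "0 < 2 powr \<beta> + 2 * 10 powr \<beta>" by (intro add_pos_pos) auto
  let ?n = "real DIM('a)"
  fix c and r :: "nat \<Rightarrow> real"
  assume r: "\<And>i. 0 \<le> r i" and cov: "U - N \<subseteq> (\<Union>i. ball (c i) (r i))"
  define \<omega> where "\<omega> = unit_ball_vol \<beta>"
  have \<omega>: "0 < \<omega>" unfolding \<omega>_def using \<beta> by simp
  define T where "T = (\<Sum>i. ennreal (r i powr \<beta>))"
  have S: "(\<Sum>i. ennreal (\<omega> * r i powr \<beta>)) = ennreal \<omega> * T"
    using \<omega> by (simp add: T_def ennreal_mult flip: ennreal_suminf_cmult)
  obtain \<rho> where \<rho>: "\<And>x. x \<in> ?W \<Longrightarrow> 0 < \<rho> x \<and> \<rho> x \<le> 1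
      \<and> emeasure lebesgue (ball x (\<rho> x)) \<le> 2 * emeasure lebesgue (U \<inter> ball x (\<rho> x))"
    using bchoice[of ?W "\<lambda>x r. 0 < r \<and> r \<le> 1
        \<and> emeasure lebesgue (ball x r) \<le> 2 * emeasure lebesgue (U \<inter> ball x r)"] by blast
  text \<open>Points of \<open>W1\<close> lie in a doubled ball of the covering. Around points of \<open>W2\<close> only balls smaller
    than \<open>\<rho> x\<close> matter, and \<open>r powr n \<le> \<rho> x powr (n - \<beta>) * r powr \<beta>\<close> turns volume into content.\<close>
  define W1 where "W1 = {x\<in>?W. \<exists>i. \<rho> x \<le> r i \<and> ball (c i) (r i) \<inter> ball x (\<rho> x) \<noteq> {}}"
  define W2 where "W2 = ?W - W1"

  have "W1 \<subseteq> (\<Union>i. ball (c i) (2 * r i))"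
  proof
    fix x assume "x \<in> W1"
    then obtain i y where "\<rho> x \<le> r i" "dist (c i) y < r i" "dist x y < \<rho> x"
      by (auto simp: W1_def)
    then have "dist (c i) x < 2 * r i"
      using dist_triangle2[of "c i" x y] by simp
    then show "x \<in> (\<Union>i. ball (c i) (2 * r i))" by auto
  qed
  then have "hausdorff_content \<beta> W1 \<le> (\<Sum>i. ennreal (\<omega> * (2 * r i) powr \<beta>))"
    unfolding \<omega>_def by (intro hausdorff_content_le) (use r in auto)
  also have "\<dots> = (\<Sum>i. ennreal (2 powr \<beta>) * ennreal (\<omega> * r i powr \<beta>))"
    using r \<omega> by (simp add: powr_mult mult_ac flip: ennreal_mult)
  also have "\<dots> = ennreal (2 powr \<beta>) * (ennreal \<omega> * T)"
    by (simp add: S)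
  finally have H1: "hausdorff_content \<beta> W1 \<le> ennreal (2 powr \<beta>) * (ennreal \<omega> * T)" .

  \<comment> \<open>A covering ball that meets \<open>ball x (\<rho> x)\<close> and is smaller than
    it has its centre in the doubled ball. Recording centres makes the sets \<open>J x\<close>
    disjoint as soon as the doubled balls are.\<close>
  define J where "J x = {i. c i \<in> ball x (2 * \<rho> x)}" for x
  \<comment> \<open>\<open>M\<close> weights each index by the cost of its ball without the factor
    \<open>\<omega>\<close>, so the disjoint costs can be summed by countable additivity.\<close>
  define M where "M = density (count_space UNIV) (\<lambda>i. ennreal (r i powr \<beta>))"
  have emM: "emeasure M A = (\<Sum>i. ennreal (r i powr \<beta>) * indicator A i)" for A
    by (simp add: M_def emeasure_density nn_integral_count_space_nat)
  have \<rho>_le: "ennreal (\<rho> x powr \<beta>) \<le> 2 * emeasure M (J x)" if x: "x \<in> W2" for x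
  proof -
    have \<rho>x: "0 < \<rho> x" "emeasure lebesgue (ball x (\<rho> x)) \<le> 2 * emeasure lebesgue (U \<inter> ball x (\<rho> x))"
      using \<rho>[of x] x by (auto simp: W2_def)
    \<comment> \<open>Chosen so that \<open>ball x (\<rho> x)\<close> has volume
      \<open>q * \<rho> x powr \<beta>\<close>, while a smaller covering ball has volume at most
      \<open>q * r i powr \<beta>\<close>. The factor \<open>q\<close> then cancels.\<close>
    define q where "q = unit_ball_vol ?n * \<rho> x powr (?n - \<beta>)"
    have q: "0 < q" using \<rho>x by (simp add: q_def)
    have "emeasure lebesgue (U \<inter> ball x (\<rho> x)) = emeasure lebesgue (U \<inter> ball x (\<rho> x) - N)"
      by (rule emeasure_Diff_null_set[symmetric, OF N]) (use U in auto)
    also have "\<dots> \<le> emeasure lebesgue (\<Union>i. ball (c i) (r i) \<inter> ball x (\<rho> x))"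
      by (rule emeasure_mono) (use cov in auto)
    also have "\<dots> \<le> (\<Sum>i. emeasure lebesgue (ball (c i) (r i) \<inter> ball x (\<rho> x)))"
      by (rule emeasure_subadditive_countably) auto
    also have "\<dots> \<le> (\<Sum>i. ennreal q * (ennreal (r i powr \<beta>) * indicator (J x) i))"
    proof (rule suminf_le)
      fix i
      show "emeasure lebesgue (ball (c i) (r i) \<inter> ball x (\<rho> x))
          \<le> ennreal q * (ennreal (r i powr \<beta>) * indicator (J x) i)"
      proof (cases "ball (c i) (r i) \<inter> ball x (\<rho> x) = {}")
        case False
        then have ri: "r i < \<rho> x" using x by (force simp: W1_def W2_def)
        from False obtain y where "dist (c i) y < r i" "dist x y < \<rho> x" by auto
        with ri have "dist x (c i) < 2 * \<rho> x"
          using dist_triangle2[of x "c i" y] by simp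
        then have i: "i \<in> J x" by (simp add: J_def)
        have "r i powr ?n = r i powr (?n - \<beta>) * r i powr \<beta>"
          by (simp flip: powr_add)
        also have "\<dots> \<le> \<rho> x powr (?n - \<beta>) * r i powr \<beta>"
          using ri r[of i] \<beta> by (intro mult_right_mono powr_mono2) auto
        finally have "unit_ball_vol ?n * r i powr ?n \<le> q * r i powr \<beta>"
          unfolding q_def by (simp add: mult.assoc)
        then have "emeasure lebesgue (ball (c i) (r i)) \<le> ennreal (q * r i powr \<beta>)"
          using r by (simp add: emeasure_lebesgue_ball ennreal_leI del: emeasure_completion)
        moreover have "emeasure lebesgue (ball (c i) (r i) \<inter> ball x (\<rho> x)) \<le> emeasure lebesgue (ball (c i) (r i))"
          by (rule emeasure_mono) auto
        ultimately show ?thesis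
          using i q by (simp add: ennreal_mult del: emeasure_completion)
      qed simp
    qed auto
    also have "\<dots> = ennreal q * emeasure M (J x)"
      by (simp add: emM)
    finally have "emeasure lebesgue (U \<inter> ball x (\<rho> x)) \<le> ennreal q * emeasure M (J x)" .
    then have "emeasure lebesgue (ball x (\<rho> x)) \<le> 2 * (ennreal q * emeasure M (J x))"
      using \<rho>x(2) by (meson mult_left_mono order_trans zero_le)
    moreover have "emeasure lebesgue (ball x (\<rho> x)) = ennreal q * ennreal (\<rho> x powr \<beta>)"
      using \<rho>x(1) by (simp add: emeasure_lebesgue_ball q_def mult.assoc flip: ennreal_mult powr_add
          del: emeasure_completion)
    ultimately have "ennreal q * ennreal (\<rho> x powr \<beta>) \<le> ennreal q * (2 * emeasure M (J x))"
      by (simp add: mult.left_commute)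
    then show ?thesis
      using q by (subst (asm) ennreal_mult_le_mult_iff) auto
  qed

  \<comment> \<open>The selection is made among the doubled balls, as disjointness of the
    \<open>J x\<close> requires. The bound \<open>\<rho> x \<le> 1\<close> supplies the uniform
    bound 2 on their radii.\<close>
  obtain C where C: "countable C" "C \<subseteq> W2"
      and disj: "pairwise (\<lambda>x y. disjnt (ball x (2 * \<rho> x)) (ball y (2 * \<rho> y))) C"
      and W2: "W2 \<subseteq> (\<Union>x\<in>C. ball x (5 * (2 * \<rho> x)))"
  proof (rule Vitali_covering_lemma_balls[where S = W2 and K = W2 and a = "\<lambda>x. x"
        and r = "\<lambda>x. 2 * \<rho> x" and B = 2])
    show "W2 \<subseteq> (\<Union>x\<in>W2. ball x (2 * \<rho> x))"
      using \<rho> by (force simp: W2_def)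
    show "\<And>x. x \<in> W2 \<Longrightarrow> 0 < 2 * \<rho> x \<and> 2 * \<rho> x \<le> 2"
      using \<rho> by (force simp: W2_def)
  qed blast
  have \<rho>0: "0 < \<rho> x" if "x \<in> C" for x using \<rho>[of x] that C by (auto simp: W2_def)
  have "hausdorff_content \<beta> W2 \<le> (\<integral>\<^sup>+x. ennreal (\<omega> * (5 * (2 * \<rho> x)) powr \<beta>) \<partial>count_space C)"
    unfolding \<omega>_def
    by (rule hausdorff_content_le_countable[OF C(1) _ W2]) (use \<rho>0 in \<open>auto intro: less_imp_le\<close>)
  also have "\<dots> \<le> (\<integral>\<^sup>+x. ennreal (2 * 10 powr \<beta> * \<omega>) * emeasure M (J x) \<partial>count_space C)"
  proof (rule nn_integral_mono)
    fix x assume "x \<in> space (count_space C)"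
    then have x: "x \<in> C" by simp
    have "ennreal (\<omega> * (5 * (2 * \<rho> x)) powr \<beta>) = ennreal (10 powr \<beta> * \<omega>) * ennreal (\<rho> x powr \<beta>)"
      using \<rho>0[OF x] \<omega> powr_mult[of 10 "\<rho> x" \<beta>] by (simp add: mult_ac flip: ennreal_mult)
    also have "\<dots> \<le> ennreal (10 powr \<beta> * \<omega>) * (2 * emeasure M (J x))"
      using \<rho>_le x C by (intro mult_left_mono) auto
    also have "\<dots> = ennreal (2 * 10 powr \<beta> * \<omega>) * emeasure M (J x)"
      using \<omega> by (simp add: ennreal_mult mult_ac)
    finally show "ennreal (\<omega> * (5 * (2 * \<rho> x)) powr \<beta>) \<le> ennreal (2 * 10 powr \<beta> * \<omega>) * emeasure M (J x)" .
  qed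
  also have "\<dots> = ennreal (2 * 10 powr \<beta> * \<omega>) * (\<integral>\<^sup>+x. emeasure M (J x) \<partial>count_space C)"
    by (simp add: nn_integral_cmult)
  also have "(\<integral>\<^sup>+x. emeasure M (J x) \<partial>count_space C) = emeasure M (\<Union>x\<in>C. J x)"
  proof (rule emeasure_UN_countable[symmetric])
    show "disjoint_family_on J C"
      using disj unfolding disjoint_family_on_def pairwise_def disjnt_def J_def by blast
  qed (use C in \<open>auto simp: M_def\<close>)
  also have "\<dots> \<le> T"
    unfolding T_def emM by (intro suminf_le) (auto simp: indicator_def)
  finally have "hausdorff_content \<beta> W2 \<le> ennreal (2 * 10 powr \<beta> * \<omega>) * T"
    by (simp add: mult_left_mono)
  then have H2: "hausdorff_content \<beta> W2 \<le> ennreal (2 * 10 powr \<beta>) * (ennreal \<omega> * T)"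
    using \<omega> by (simp add: ennreal_mult mult.assoc)

  have "hausdorff_content \<beta> ?W \<le> hausdorff_content \<beta> (W1 \<union> W2)"
    by (rule hausdorff_content_mono) (auto simp: W2_def)
  also have "\<dots> \<le> hausdorff_content \<beta> W1 + hausdorff_content \<beta> W2"
    by (rule hausdorff_content_Un_le)
  also have "\<dots> \<le> ennreal (2 powr \<beta>) * (ennreal \<omega> * T) + ennreal (2 * 10 powr \<beta>) * (ennreal \<omega> * T)"
    using H1 H2 by (rule add_mono)
  also have "\<dots> = ennreal (2 powr \<beta> + 2 * 10 powr \<beta>) * (\<Sum>i. ennreal (unit_ball_vol \<beta> * r i powr \<beta>))"
    unfolding \<omega>_def S[unfolded \<omega>_def] by (simp add: ennreal_plus distrib_right)
  finally show "hausdorff_content \<beta> ?W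
    \<le> ennreal (2 powr \<beta> + 2 * 10 powr \<beta>) * (\<Sum>i. ennreal (unit_ball_vol \<beta> * r i powr \<beta>))" .
qed

subsection \<open>Lebesgue values and the density theorem\<close>

lemma set_integrable_abs_diff_const:
  fixes f :: "'a::euclidean_space \<Rightarrow> real"
  assumes "set_integrable lebesgue \<Omega> f" "A \<subseteq> \<Omega>" "A \<in> lmeasurable"
  shows "set_integrable lebesgue A (\<lambda>y. \<bar>f y - a\<bar>)"
proof -
  have "set_integrable lebesgue A f"
    using assms by (intro set_integrable_subset[OF assms(1)]) auto
  moreover have "set_integrable lebesgue A (\<lambda>_. a)"
    using assms(3) by (simp add: set_integrable_def lmeasurable_iff_integrable)
  ultimately show ?thesis
    by (intro set_integrable_abs set_integral_diff)
qed

lemma eventually_ball_subset: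
  fixes x :: "'a::euclidean_space"
  assumes "open \<Omega>" "x \<in> \<Omega>" "0 < d"
  shows "\<forall>\<^sub>F r in at_right 0. 0 < r \<and> r \<le> (d::real) \<and> ball x r \<subseteq> \<Omega>"
proof -
  obtain R where R: "0 < R" "ball x R \<subseteq> \<Omega>"
    using assms by (meson open_contains_ball)
  have "\<forall>\<^sub>F r in at_right 0. r \<in> {0<..<min R d}"
    using R assms by (intro eventually_at_right_real) auto
  then show ?thesis
    by eventually_elim (use R in \<open>auto simp: subset_iff\<close>)
qed

text \<open>The constant \<open>\<bar>a - b\<bar>\<close> is its own average and is dominated by two
  averages tending to 0. Integrability matters: Bochner integrals of non-integrable functions
  default to 0, so uniqueness could otherwise fail. This justifies the definite description in
  \<open>precise_rep\<close>.\<close>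

lemma is_lebesgue_value_unique:
  fixes f :: "'a::euclidean_space \<Rightarrow> real"
  assumes \<Omega>: "open \<Omega>" "x \<in> \<Omega>" and f: "set_integrable lebesgue \<Omega> f"
    and a: "is_lebesgue_value f x a" and b: "is_lebesgue_value f x b"
  shows "a = b"
proof -
  let ?av = "\<lambda>a r. 1 / measure lebesgue (ball x r) * (LINT y:ball x r|lebesgue. \<bar>f y - a\<bar>)"
  have "((\<lambda>r. ?av a r + ?av b r) \<longlongrightarrow> 0 + 0) (at_right 0)"
    using a b unfolding is_lebesgue_value_def by (rule tendsto_add)
  moreover have "\<forall>\<^sub>F r in at_right 0. \<bar>a - b\<bar> \<le> ?av a r + ?av b r"
    using eventually_ball_subset[OF \<Omega> zero_less_one]
  proof eventually_elim
    case (elim r)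
    let ?m = "measure lebesgue (ball x r)"
    have m: "0 < ?m" using elim by (simp add: content_ball_gt_0_iff)
    have int: "set_integrable lebesgue (ball x r) (\<lambda>y. \<bar>f y - a\<bar>)" for a
      using elim by (intro set_integrable_abs_diff_const[OF f]) auto
    have "integrable lebesgue (indicat_real (ball x r))"
      by (simp flip: lmeasurable_iff_integrable)
    then have const: "set_integrable lebesgue (ball x r) (\<lambda>_. \<bar>a - b\<bar>)"
      by (simp add: set_integrable_def)
    have "\<bar>a - b\<bar> * ?m = (LINT y:ball x r|lebesgue. \<bar>a - b\<bar>)"
      by (simp add: set_lebesgue_integral_def)
    also have "\<dots> \<le> (LINT y:ball x r|lebesgue. \<bar>f y - a\<bar> + \<bar>f y - b\<bar>)"
      by (intro set_integral_mono set_integral_add int const) auto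
    also have "\<dots> = (LINT y:ball x r|lebesgue. \<bar>f y - a\<bar>) + (LINT y:ball x r|lebesgue. \<bar>f y - b\<bar>)"
      by (intro set_integral_add int)
    finally have "\<bar>a - b\<bar> \<le> ((LINT y:ball x r|lebesgue. \<bar>f y - a\<bar>) + (LINT y:ball x r|lebesgue. \<bar>f y - b\<bar>)) / ?m"
      using m by (simp add: pos_le_divide_eq)
    then show ?case by (simp add: add_divide_distrib)
  qed
  ultimately have "\<bar>a - b\<bar> \<le> 0 + 0"
    by (rule tendsto_lowerbound) simp
  then show ?thesis by simp
qed

lemma precise_rep_eq:
  fixes f :: "'a::euclidean_space \<Rightarrow> real"
  assumes "open \<Omega>" "x \<in> \<Omega>" "set_integrable lebesgue \<Omega> f" "is_lebesgue_value f x a"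
  shows "precise_rep f x = a"
  unfolding precise_rep_def using assms by (blast intro: the_equality is_lebesgue_value_unique)

lemma lebesgue_points_precise_rep:
  fixes f :: "'a::euclidean_space \<Rightarrow> real"
  assumes "open \<Omega>" "set_integrable lebesgue \<Omega> f" "x \<in> lebesgue_points \<Omega> f"
  shows "is_lebesgue_value f x (precise_rep f x)"
  using assms precise_rep_eq[OF assms(1) _ assms(2)] by (auto simp: lebesgue_points_def)

lemma set_integrable_imp_sets_gt:
  fixes g :: "'a::euclidean_space \<Rightarrow> real"
  assumes \<Omega>: "open \<Omega>" and g: "set_integrable lebesgue \<Omega> g"
  shows "{y\<in>\<Omega>. g y > t} \<in> sets lebesgue"
proof -
  have [measurable]: "(\<lambda>y. indicator \<Omega> y *\<^sub>R g y) \<in> borel_measurable lebesgue"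
    using g unfolding set_integrable_def by (rule borel_measurable_integrable)
  have [measurable]: "\<Omega> \<in> sets lebesgue" using \<Omega> by simp
  have "{y\<in>\<Omega>. g y > t} = \<Omega> \<inter> {y\<in>space lebesgue. indicator \<Omega> y *\<^sub>R g y > t}"
    by (auto simp: indicator_def)
  also have "\<dots> \<in> sets lebesgue" by measurable
  finally show ?thesis .
qed

text \<open>Markov's inequality: off the superlevel set
  \<open>\<bar>g y - a\<bar> \<ge> a - t\<close>, so once the average of
  \<open>\<bar>g y - a\<bar>\<close> is below \<open>(a - t) / 2\<close>, at most half of the ball
  lies off that set. The bound \<open>r \<le> 1\<close> is what the Vitali argument asks of the
  radii.\<close>

lemma is_lebesgue_value_half_ball:
  fixes g :: "'a::euclidean_space \<Rightarrow> real"
  assumes \<Omega>: "open \<Omega>" "x \<in> \<Omega>" and g: "set_integrable lebesgue \<Omega> g"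
    and a: "is_lebesgue_value g x a" "t < a"
  shows "\<exists>r. 0 < r \<and> r \<le> 1
    \<and> emeasure lebesgue (ball x r) \<le> 2 * emeasure lebesgue ({y\<in>\<Omega>. g y > t} \<inter> ball x r)"
proof -
  let ?G = "{y\<in>\<Omega>. g y > t}"
  have G: "?G \<in> sets lebesgue" using \<Omega> g by (intro set_integrable_imp_sets_gt)
  let ?av = "\<lambda>r. 1 / measure lebesgue (ball x r) * (LINT y:ball x r|lebesgue. \<bar>g y - a\<bar>)"
  have "\<forall>\<^sub>F r in at_right 0. ?av r < (a - t) / 2"
    using a unfolding is_lebesgue_value_def by (intro order_tendstoD(2)) auto
  from eventually_happens[OF eventually_conj[OF this eventually_ball_subset[OF \<Omega> zero_less_one]]]
  obtain r where r: "?av r < (a - t) / 2" "0 < r" "r \<le> 1" "ball x r \<subseteq> \<Omega>"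
    by auto
  let ?m = "measure lebesgue (ball x r)"
  have m: "0 < ?m" using r by (simp add: content_ball_gt_0_iff)
  have BG: "?G \<inter> ball x r \<in> lmeasurable" "ball x r - ?G \<in> lmeasurable"
    using G by (auto intro!: fmeasurable_Diff fmeasurable_Int_fmeasurable simp: Int_commute)
  have eq: "(\<lambda>y. indicator (ball x r) y *\<^sub>R ((a - t) * indicator (ball x r - ?G) y))
      = (\<lambda>y. (a - t) * indicat_real (ball x r - ?G) y)"
    by (auto simp: fun_eq_iff indicator_def)
  have "(a - t) * measure lebesgue (ball x r - ?G)
      = (LINT y:ball x r|lebesgue. (a - t) * indicator (ball x r - ?G) y)"
    unfolding set_lebesgue_integral_def eq by simp
  also have "\<dots> \<le> (LINT y:ball x r|lebesgue. \<bar>g y - a\<bar>)"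
  proof (rule set_integral_mono)
    show "set_integrable lebesgue (ball x r) (\<lambda>y. (a - t) * indicator (ball x r - ?G) y)"
      unfolding set_integrable_def eq using BG(2) by (simp add: lmeasurable_iff_integrable)
    show "set_integrable lebesgue (ball x r) (\<lambda>y. \<bar>g y - a\<bar>)"
      using r by (intro set_integrable_abs_diff_const[OF g]) auto
    show "(a - t) * indicator (ball x r - ?G) y \<le> \<bar>g y - a\<bar>" if "y \<in> ball x r" for y
      using that r a by (auto simp: indicator_def)
  qed
  also have "\<dots> \<le> (a - t) / 2 * ?m"
    using r(1) m by (simp add: field_simps)
  finally have "(a - t) * measure lebesgue (ball x r - ?G) \<le> (a - t) * (?m / 2)"
    by simp
  then have "measure lebesgue (ball x r - ?G) \<le> ?m / 2"
    using a by (subst (asm) mult_le_cancel_left_pos) auto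
  moreover have "?m = measure lebesgue (?G \<inter> ball x r) + measure lebesgue (ball x r - ?G)"
  proof -
    have "?G \<inter> ball x r \<union> ball x r = ball x r" "ball x r - ?G \<inter> ball x r = ball x r - ?G" by auto
    then show ?thesis using measure_Un2[OF BG(1) lmeasurable_ball, of x r] by simp
  qed
  ultimately have "?m \<le> 2 * measure lebesgue (?G \<inter> ball x r)" by simp
  then have "ennreal ?m \<le> 2 * ennreal (measure lebesgue (?G \<inter> ball x r))"
    by (metis ennreal_leI ennreal_mult' ennreal_numeral measure_nonneg zero_le_numeral)
  then show ?thesis
    using r BG by (auto simp: emeasure_eq_measure2 simp del: emeasure_completion)
qed

section \<open>Lebesgue's density theorem for sets\<close>

lemma is_lebesgue_value_indicator_iff:
  fixes U :: "'a::euclidean_space set"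
  shows "is_lebesgue_value (indicator U) x 1 \<longleftrightarrow>
    ((\<lambda>r. measure lebesgue (ball x r - U) / measure lebesgue (ball x r)) \<longlongrightarrow> 0) (at_right 0)"
proof -
  have "(LINT y:ball x r|lebesgue. \<bar>indicator U y - 1\<bar>) = measure lebesgue (ball x r - U)" for r
  proof -
    have "(\<lambda>y. indicator (ball x r) y *\<^sub>R \<bar>indicator U y - 1\<bar>) = indicat_real (ball x r - U)"
      by (auto simp: fun_eq_iff indicator_def)
    then show ?thesis by (simp add: set_lebesgue_integral_def)
  qed
  then show ?thesis by (simp add: is_lebesgue_value_def)
qed

lemma is_lebesgue_value_indicator_open:
  fixes U :: "'a::euclidean_space set"
  assumes "open U" "x \<in> U"
  shows "is_lebesgue_value (indicator U) x 1"
  unfolding is_lebesgue_value_indicator_iff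
proof (rule tendsto_eventually)
  show "\<forall>\<^sub>F r in at_right 0. measure lebesgue (ball x r - U) / measure lebesgue (ball x r) = 0"
    using eventually_ball_subset[OF assms zero_less_one]
  proof eventually_elim
    case (elim r)
    then have "ball x r - U = {}" by auto
    then have "measure lebesgue (ball x r - U) = 0" by (simp only: measure_empty)
    then show ?case by simp
  qed
qed

text \<open>Countable subadditivity in the form needed for a Vitali family indexed by its centres:
  the indicator of the union is at most the sum of the indicators.\<close>

lemma emeasure_UN_countable_le:
  assumes [measurable]: "\<And>i. i \<in> I \<Longrightarrow> X i \<in> sets M" and I: "countable I"
  shows "emeasure M (\<Union>i\<in>I. X i) \<le> (\<integral>\<^sup>+i. emeasure M (X i) \<partial>count_space I)"
proof -
  have "(\<Union>i\<in>I. X i) \<in> sets M" using I by (intro sets.countable_UN') auto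
  then have "emeasure M (\<Union>i\<in>I. X i) = (\<integral>\<^sup>+x. indicator (\<Union>i\<in>I. X i) x \<partial>M)"
    by simp
  also have "\<dots> \<le> (\<integral>\<^sup>+x. \<integral>\<^sup>+i. indicator (X i) x \<partial>count_space I \<partial>M)"
  proof (rule nn_integral_mono)
    fix x
    show "indicator (\<Union>i\<in>I. X i) x \<le> (\<integral>\<^sup>+i. indicator (X i) x \<partial>count_space I :: ennreal)"
    proof (cases "x \<in> (\<Union>i\<in>I. X i)")
      case True
      then obtain j where "j \<in> I" "x \<in> X j" by auto
      then show ?thesis
        using True nn_integral_ge_point[of j I "\<lambda>i. indicator (X i) x"] by simp
    qed simp
  qed
  also have "\<dots> = (\<integral>\<^sup>+i. \<integral>\<^sup>+x. indicator (X i) x \<partial>M \<partial>count_space I)"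
    using I by (rule nn_integral_count_space_nn_integral) auto
  also have "\<dots> = (\<integral>\<^sup>+i. emeasure M (X i) \<partial>count_space I)"
    by (rule nn_integral_cong) simp
  finally show ?thesis .
qed

text \<open>Take an open \<open>T\<close> containing \<open>U\<close> with little volume in
  \<open>T - U\<close>, and select disjoint bad balls inside \<open>T\<close>. Each fivefold ball
  has volume at most \<open>5 ^ n * k\<close> times the part of its original outside
  \<open>U\<close>. These parts are disjoint in \<open>T - U\<close>, so the exceptional set has
  covers of arbitrarily small volume.\<close>

lemma negligible_low_density:
  fixes U :: "'a::euclidean_space set"
  assumes U: "U \<in> sets lebesgue" and k: "0 < k"
  shows "negligible {x\<in>U. \<forall>d>0. \<exists>r. 0 < r \<and> r < d
    \<and> measure lebesgue (ball x r) \<le> k * measure lebesgue (ball x r - U)}"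
    (is "negligible ?S")
proof -
  define S where "S = ?S"
  have SU: "S \<subseteq> U" by (auto simp: S_def)
  have Sr: "\<exists>r. 0 < r \<and> r < d \<and> measure lebesgue (ball x r) \<le> k * measure lebesgue (ball x r - U)"
    if "x \<in> S" "0 < d" for x d
    using that unfolding S_def by blast
  have "negligible S"
    unfolding negligible_outer_le
  proof (intro allI impI)
    fix e :: real assume e: "0 < e"
    let ?n = "DIM('a)"
    \<comment> \<open>Total loss: \<open>5 ^ n\<close> from Vitali's enlargement and
      \<open>k\<close> from the density defect. Asking for less than \<open>e / q\<close> in
      \<open>T - U\<close> makes the final bound exactly \<open>e\<close>.\<close>
    define q where "q = 5 ^ ?n * k"
    have q: "0 < q" using k by (simp add: q_def)
    obtain T where T: "open T" "U \<subseteq> T" "T - U \<in> lmeasurable" "emeasure lebesgue (T - U) < ennreal (e / q)"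
      using sets_lebesgue_outer_open[OF U, of "e / q"] e q by auto
    have "\<exists>r. 0 < r \<and> r \<le> 1 \<and> ball x r \<subseteq> T \<and> measure lebesgue (ball x r) \<le> k * measure lebesgue (ball x r - U)"
      if x: "x \<in> S" for x
    proof -
      have "x \<in> T" using x SU T(2) by blast
      then obtain R where R: "0 < R" "ball x R \<subseteq> T" using T(1) open_contains_ball by blast
      have "0 < min R 1" using R by simp
      then obtain r where "0 < r" "r < min R 1" "measure lebesgue (ball x r) \<le> k * measure lebesgue (ball x r - U)"
        using Sr[OF x] by blast
      moreover have "ball x r \<subseteq> ball x R" using \<open>r < min R 1\<close> by (intro subset_ball) simp
      ultimately show ?thesis using R by (intro exI[of _ r]) auto
    qed
    then obtain \<rho> where \<rho>: "\<And>x. x \<in> S \<Longrightarrow> 0 < \<rho> x \<and> \<rho> x \<le> 1 \<and> ball x (\<rho> x) \<subseteq> T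
        \<and> measure lebesgue (ball x (\<rho> x)) \<le> k * measure lebesgue (ball x (\<rho> x) - U)"
      using bchoice[of S "\<lambda>x r. 0 < r \<and> r \<le> 1 \<and> ball x r \<subseteq> T
        \<and> measure lebesgue (ball x r) \<le> k * measure lebesgue (ball x r - U)"] by blast
    obtain C where C: "countable C" "C \<subseteq> S"
        and disj: "pairwise (\<lambda>x y. disjnt (ball x (\<rho> x)) (ball y (\<rho> y))) C"
        and cov: "S \<subseteq> (\<Union>x\<in>C. ball x (5 * \<rho> x))"
    proof (rule Vitali_covering_lemma_balls[where S = S and K = S and a = "\<lambda>x. x"
          and r = \<rho> and B = 1])
      show "S \<subseteq> (\<Union>x\<in>S. ball x (\<rho> x))"
      proof
        fix x assume "x \<in> S"
        with \<rho>[OF this] show "x \<in> (\<Union>x\<in>S. ball x (\<rho> x))" by (intro UN_I[of x]) simp_all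
      qed
      show "0 < \<rho> x \<and> \<rho> x \<le> 1" if "x \<in> S" for x using \<rho>[OF that] by simp
    qed blast
    let ?T = "\<Union>x\<in>C. ball x (5 * \<rho> x)"
    have "emeasure lebesgue ?T \<le> (\<integral>\<^sup>+x. emeasure lebesgue (ball x (5 * \<rho> x)) \<partial>count_space C)"
      using C(1) by (intro emeasure_UN_countable_le) auto
    also have "\<dots> \<le> (\<integral>\<^sup>+x. ennreal q * emeasure lebesgue (ball x (\<rho> x) - U) \<partial>count_space C)"
    proof (rule nn_integral_mono)
      fix x assume "x \<in> space (count_space C)"
      then have x: "x \<in> S" using C by auto
      have m: "ball x (\<rho> x) - U \<in> lmeasurable" using U by (auto intro: fmeasurable_Diff)
      have "measure lebesgue (ball x (5 * \<rho> x)) = 5 ^ ?n * measure lebesgue (ball x (\<rho> x))"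
        using \<rho>[OF x] by (simp add: content_ball power_mult_distrib)
      also have "\<dots> \<le> 5 ^ ?n * (k * measure lebesgue (ball x (\<rho> x) - U))"
        using \<rho>[OF x] by (intro mult_left_mono) auto
      finally have "measure lebesgue (ball x (5 * \<rho> x)) \<le> q * measure lebesgue (ball x (\<rho> x) - U)"
        by (simp add: q_def mult.assoc)
      then show "emeasure lebesgue (ball x (5 * \<rho> x)) \<le> ennreal q * emeasure lebesgue (ball x (\<rho> x) - U)"
        using q m by (simp add: emeasure_eq_measure2 ennreal_leI flip: ennreal_mult del: emeasure_completion)
    qed
    also have "\<dots> = ennreal q * (\<integral>\<^sup>+x. emeasure lebesgue (ball x (\<rho> x) - U) \<partial>count_space C)"
      by (simp add: nn_integral_cmult del: emeasure_completion)
    also have "(\<integral>\<^sup>+x. emeasure lebesgue (ball x (\<rho> x) - U) \<partial>count_space C)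
        = emeasure lebesgue (\<Union>x\<in>C. ball x (\<rho> x) - U)"
    proof (rule emeasure_UN_countable[symmetric])
      show "disjoint_family_on (\<lambda>x. ball x (\<rho> x) - U) C"
        using disj unfolding disjoint_family_on_def pairwise_def disjnt_def by blast
    qed (use C U in auto)
    also have "\<dots> \<le> emeasure lebesgue (T - U)"
    proof (rule emeasure_mono)
      show "(\<Union>x\<in>C. ball x (\<rho> x) - U) \<subseteq> T - U" using \<rho> C(2) by blast
      show "T - U \<in> sets lebesgue" using T(3) by (rule fmeasurableD)
    qed
    also have "\<dots> \<le> ennreal (e / q)" using T(4) by (rule less_imp_le)
    finally have "emeasure lebesgue ?T \<le> ennreal q * ennreal (e / q)"
      by (simp add: mult_left_mono del: emeasure_completion)
    also have "\<dots> = ennreal e" using q e by (simp flip: ennreal_mult)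
    finally have le: "emeasure lebesgue ?T \<le> ennreal e" .
    have "?T \<in> sets lebesgue" using C(1) by (intro sets.countable_UN') auto
    moreover have "emeasure lebesgue ?T < \<infinity>"
      using le_less_trans[OF le ennreal_less_top] by simp
    ultimately have "?T \<in> lmeasurable"
      by (intro fmeasurableI)
    moreover have "measure lebesgue ?T \<le> e"
      unfolding measure_def using e le by (intro enn2real_leI) auto
    ultimately show "\<exists>T. S \<subseteq> T \<and> T \<in> lmeasurable \<and> measure lebesgue T \<le> e"
      using cov by blast
  qed
  then show ?thesis unfolding S_def .
qed

text \<open>If the fraction of the ball outside \<open>U\<close> does not tend to 0, it is at least
  \<open>1 / Suc k\<close> along radii tending to 0 for some \<open>k\<close>. The exceptional set
  therefore lies in a countable union of negligible sets.\<close>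

lemma lebesgue_density:
  fixes U :: "'a::euclidean_space set"
  assumes U: "U \<in> sets lebesgue"
  shows "negligible {x\<in>U. \<not> is_lebesgue_value (indicator U) x 1}"
proof (rule negligible_subset)
  let ?S = "\<lambda>k::nat. {x\<in>U. \<forall>d>0. \<exists>r. 0 < r \<and> r < d
    \<and> measure lebesgue (ball x r) \<le> real (Suc k) * measure lebesgue (ball x r - U)}"
  show "negligible (\<Union>k. ?S k)"
    by (intro negligible_Union_nat negligible_low_density[OF U]) simp
  show "{x\<in>U. \<not> is_lebesgue_value (indicator U) x 1} \<subseteq> (\<Union>k. ?S k)"
  proof (rule subsetI, rule ccontr)
    fix x assume x: "x \<in> {x\<in>U. \<not> is_lebesgue_value (indicator U) x 1}" and "x \<notin> (\<Union>k. ?S k)"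
    with x have *: "\<exists>d>0. \<forall>r. 0 < r \<and> r < d \<longrightarrow>
      real (Suc k) * measure lebesgue (ball x r - U) < measure lebesgue (ball x r)" for k
      unfolding not_le[symmetric] by blast
    have "is_lebesgue_value (indicator U) x 1"
      unfolding is_lebesgue_value_indicator_iff
    proof (rule tendstoI)
      fix e :: real assume "0 < e"
      then obtain k where k: "inverse (real (Suc k)) < e" using reals_Archimedean by blast
      obtain d where d: "0 < d" "\<And>r. 0 < r \<Longrightarrow> r < d \<Longrightarrow>
        real (Suc k) * measure lebesgue (ball x r - U) < measure lebesgue (ball x r)"
        using *[of k] by blast
      have "\<forall>\<^sub>F r in at_right 0. r \<in> {0<..<d}"
        using d(1) by (rule eventually_at_right_real)
      then show "\<forall>\<^sub>F r in at_right 0. dist (measure lebesgue (ball x r - U) / measure lebesgue (ball x r)) 0 < e"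
      proof eventually_elim
        case (elim r)
        then have m: "0 < measure lebesgue (ball x r)" by (simp add: content_ball_gt_0_iff)
        have "measure lebesgue (ball x r - U) / measure lebesgue (ball x r) < inverse (real (Suc k))"
          using d(2)[of r] elim m by (simp add: field_simps del: of_nat_Suc)
        then show ?case using k by simp
      qed
    qed
    with x show False by simp
  qed
qed

subsection \<open>Level sets and the fractional energy\<close>

text \<open>Needed to apply Tonelli's theorem to the completed measure; the Borel sets exhausting
  space for \<open>lborel\<close> keep their finite measures under completion.\<close>

lemma sigma_finite_lebesgue: "sigma_finite_measure (lebesgue :: 'a::euclidean_space measure)"
proof
  obtain A :: "'a set set" where "countable A" "A \<subseteq> sets lborel" "\<Union>A = space lborel"
    "\<forall>a\<in>A. emeasure lborel a \<noteq> \<infinity>"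
    using lborel.sigma_finite_countable by blast
  then show "\<exists>A::'a set set. countable A \<and> A \<subseteq> sets lebesgue \<and> \<Union>A = space lebesgue
      \<and> (\<forall>a\<in>A. emeasure lebesgue a \<noteq> \<infinity>)"
    by (intro exI[of _ A]) (auto simp: subset_iff)
qed

interpretation lebesgue: sigma_finite_measure "lebesgue :: 'a::euclidean_space measure"
  by (rule sigma_finite_lebesgue)

interpretation lebesgue_pair: pair_sigma_finite "lebesgue :: 'a::euclidean_space measure"
  "lebesgue :: 'b::euclidean_space measure" ..

interpretation lborel_lebesgue: pair_sigma_finite "lborel :: 'b::euclidean_space measure"
  "lebesgue :: 'a::euclidean_space measure" ..

text \<open>The first coordinate is the outer variable \<open>y\<close>, whose boundary distance
  sets the cutoff; the kernel is not symmetric. On the diagonal the weight is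
  \<open>1 / 0 = 0\<close>, in agreement with the vanishing integrand of the energy.\<close>

definition frac_kernel :: "real \<Rightarrow> real \<Rightarrow> 'a::euclidean_space set \<Rightarrow> 'a \<times> 'a \<Rightarrow> ennreal" where
  "frac_kernel \<delta> \<tau> \<Omega> p =
    (if fst p \<in> \<Omega> \<and> snd p \<in> \<Omega> \<and> norm (snd p - fst p) < \<tau> * bdry_dist \<Omega> (fst p)
     then ennreal (1 / norm (snd p - fst p) powr (real DIM('a) + \<delta>)) else 0)"

lemma borel_measurable_frac_kernel:
  fixes \<Omega> :: "'a::euclidean_space set"
  assumes "open \<Omega>"
  shows "frac_kernel \<delta> \<tau> \<Omega> \<in> borel_measurable (lebesgue \<Otimes>\<^sub>M lebesgue)"
proof -
  have id: "(\<lambda>x::'a. x) \<in> borel_measurable lebesgue"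
    by (intro measurable_completion) simp
  have [measurable]: "fst \<in> borel_measurable ((lebesgue :: 'a measure) \<Otimes>\<^sub>M (lebesgue :: 'a measure))"
    by (rule measurable_compose[OF measurable_fst id])
  have [measurable]: "snd \<in> borel_measurable ((lebesgue :: 'a measure) \<Otimes>\<^sub>M (lebesgue :: 'a measure))"
    by (rule measurable_compose[OF measurable_snd id])
  have [measurable]: "\<Omega> \<in> sets borel" using assms by simp
  have [measurable]: "bdry_dist \<Omega> \<in> borel_measurable borel"
    unfolding bdry_dist_def by (intro borel_measurable_continuous_onI continuous_intros)
  show ?thesis
    unfolding frac_kernel_def by measurable
qed

lemma frac_energy_cong:
  assumes "\<And>x. x \<in> \<Omega> \<Longrightarrow> f x = g x"
  shows "frac_energy \<delta> \<tau> f \<Omega> = frac_energy \<delta> \<tau> g \<Omega>"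
  unfolding frac_energy_def
  by (intro nn_integral_cong) (auto simp: indicator_def assms intro!: nn_integral_cong)

lemma frac_energy_mono:
  assumes "\<And>x y. x \<in> \<Omega> \<Longrightarrow> y \<in> \<Omega> \<Longrightarrow> \<bar>f x - f y\<bar> \<le> \<bar>g x - g y\<bar>"
  shows "frac_energy \<delta> \<tau> f \<Omega> \<le> frac_energy \<delta> \<tau> g \<Omega>"
  unfolding frac_energy_def
  by (intro nn_integral_mono)
    (auto simp: indicator_def intro!: nn_integral_mono ennreal_leI divide_right_mono assms)

text \<open>Putting the \<open>y\<close>-dependent inner domain into the kernel turns the energy
  into one integral over a fixed product space, so that a level parameter can later be exchanged
  with both space variables at once.\<close>

lemma frac_energy_eq_kernel:
  fixes \<Omega> :: "'a::euclidean_space set"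
  assumes "open \<Omega>" and f[measurable]: "f \<in> borel_measurable lebesgue"
  shows "frac_energy \<delta> \<tau> f \<Omega> = (\<integral>\<^sup>+p. ennreal \<bar>f (snd p) - f (fst p)\<bar> * frac_kernel \<delta> \<tau> \<Omega> p
    \<partial>(lebesgue \<Otimes>\<^sub>M lebesgue))"
proof -
  note [measurable] = borel_measurable_frac_kernel[OF assms(1)]
  have "(\<integral>\<^sup>+p. ennreal \<bar>f (snd p) - f (fst p)\<bar> * frac_kernel \<delta> \<tau> \<Omega> p \<partial>(lebesgue \<Otimes>\<^sub>M lebesgue))
    = (\<integral>\<^sup>+y. \<integral>\<^sup>+x. ennreal \<bar>f x - f y\<bar> * frac_kernel \<delta> \<tau> \<Omega> (y, x) \<partial>lebesgue \<partial>lebesgue)"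
    by (subst lebesgue.nn_integral_fst[symmetric]) simp_all
  also have "\<dots> = frac_energy \<delta> \<tau> f \<Omega>"
    unfolding frac_energy_def
  proof (rule nn_integral_cong)
    fix y :: 'a
    let ?S = "{x \<in> \<Omega>. norm (x - y) < \<tau> * bdry_dist \<Omega> y}"
    show "(\<integral>\<^sup>+x. ennreal \<bar>f x - f y\<bar> * frac_kernel \<delta> \<tau> \<Omega> (y, x) \<partial>lebesgue)
      = (\<integral>\<^sup>+x\<in>?S. ennreal (\<bar>f x - f y\<bar> / norm (x - y) powr (real DIM('a) + \<delta>)) \<partial>lebesgue) * indicator \<Omega> y"
    proof (cases "y \<in> \<Omega>")
      case True
      then show ?thesis
        by (auto simp: frac_kernel_def indicator_def simp flip: ennreal_mult intro!: nn_integral_cong)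
    qed (simp add: frac_kernel_def)
  qed
  finally show ?thesis by simp
qed

text \<open>Exactly the levels between \<open>a\<close> and \<open>b\<close> separate them. Keeping
  only positive levels leaves an inequality.\<close>

lemma nn_integral_abs_diff_levels:
  fixes a b :: real
  shows "(\<integral>\<^sup>+t. ennreal \<bar>of_bool (t < a) - of_bool (t < b)\<bar> * indicator {0<..} t \<partial>lborel) \<le> ennreal \<bar>a - b\<bar>"
proof -
  have "(\<integral>\<^sup>+t. ennreal \<bar>of_bool (t < a) - of_bool (t < b)\<bar> * indicator {0<..} t \<partial>lborel)
    \<le> (\<integral>\<^sup>+t. indicator {min a b..max a b} t \<partial>lborel)"
    by (intro nn_integral_mono) (auto simp: indicator_def)
  also have "\<dots> = ennreal \<bar>a - b\<bar>"
    by (simp add: abs_if max_def min_def)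
  finally show ?thesis .
qed

text \<open>One-sided coarea inequality: Tonelli's theorem moves the level integral inside the
  double integral, where the pointwise level bound applies. Measurability in \<open>t\<close> is
  recorded because sums of these perimeters serve as majorants under later integrals.\<close>

lemma frac_perimeter_superlevel:
  fixes \<Omega> :: "'a::euclidean_space set"
  assumes \<Omega>: "open \<Omega>" and g: "set_borel_measurable lebesgue \<Omega> g"
  shows frac_perimeter_superlevel_measurable:
      "(\<lambda>t. frac_perimeter \<delta> \<tau> {x\<in>\<Omega>. t < g x} \<Omega>) \<in> borel_measurable borel"
    and nn_integral_frac_perimeter_le:
      "(\<integral>\<^sup>+t\<in>{0<..}. frac_perimeter \<delta> \<tau> {x\<in>\<Omega>. t < g x} \<Omega> \<partial>lborel) \<le> frac_energy \<delta> \<tau> g \<Omega>"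
proof -
  note [measurable] = borel_measurable_frac_kernel[OF \<Omega>]
  \<comment> \<open>Extension by zero gives a function measurable on the whole space; the energy
    sees only values in \<open>\<Omega>\<close>, so nothing changes.\<close>
  define h where "h x = indicator \<Omega> x *\<^sub>R g x" for x
  have h[measurable]: "h \<in> borel_measurable lebesgue"
    using g unfolding h_def set_borel_measurable_def .
  have [measurable]: "\<Omega> \<in> sets lebesgue" using \<Omega> by simp
  let ?L = "lebesgue \<Otimes>\<^sub>M (lebesgue :: 'a measure)"
  let ?e = "\<lambda>t p. ennreal \<bar>of_bool (t < h (snd p)) - of_bool (t < h (fst p))\<bar>"
  have L: "sigma_finite_measure ?L" ..
  interpret P: pair_sigma_finite "lborel :: real measure" ?L ..
  have eq: "frac_perimeter \<delta> \<tau> {x\<in>\<Omega>. t < g x} \<Omega> = (\<integral>\<^sup>+p. ?e t p * frac_kernel \<delta> \<tau> \<Omega> p \<partial>?L)" for t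
  proof -
    have "frac_perimeter \<delta> \<tau> {x\<in>\<Omega>. t < g x} \<Omega> = frac_energy \<delta> \<tau> (\<lambda>x. of_bool (t < h x)) \<Omega>"
      unfolding frac_perimeter_def by (rule frac_energy_cong) (auto simp: h_def)
    also have "\<dots> = (\<integral>\<^sup>+p. ?e t p * frac_kernel \<delta> \<tau> \<Omega> p \<partial>?L)"
      by (rule frac_energy_eq_kernel[OF \<Omega>]) measurable
    finally show ?thesis .
  qed
  have meas[measurable]: "(\<lambda>(t, p). ?e t p * frac_kernel \<delta> \<tau> \<Omega> p) \<in> borel_measurable (lborel \<Otimes>\<^sub>M ?L)"
    by measurable
  show "(\<lambda>t. frac_perimeter \<delta> \<tau> {x\<in>\<Omega>. t < g x} \<Omega>) \<in> borel_measurable borel"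
    unfolding eq using sigma_finite_measure.borel_measurable_nn_integral[OF L meas] by simp
  have "(\<integral>\<^sup>+t\<in>{0<..}. frac_perimeter \<delta> \<tau> {x\<in>\<Omega>. t < g x} \<Omega> \<partial>lborel)
    = (\<integral>\<^sup>+t. \<integral>\<^sup>+p. ?e t p * frac_kernel \<delta> \<tau> \<Omega> p * indicator {0<..} t \<partial>?L \<partial>lborel)"
    unfolding eq by (intro nn_integral_cong nn_integral_multc[symmetric]) measurable
  also have "\<dots> = (\<integral>\<^sup>+p. \<integral>\<^sup>+t. ?e t p * frac_kernel \<delta> \<tau> \<Omega> p * indicator {0<..} t \<partial>lborel \<partial>?L)"
    by (rule P.Fubini'[symmetric]) measurable
  also have "\<dots> \<le> (\<integral>\<^sup>+p. ennreal \<bar>h (snd p) - h (fst p)\<bar> * frac_kernel \<delta> \<tau> \<Omega> p \<partial>?L)"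
  proof (rule nn_integral_mono)
    fix p :: "'a \<times> 'a"
    have "(\<integral>\<^sup>+t. ?e t p * frac_kernel \<delta> \<tau> \<Omega> p * indicator {0<..} t \<partial>lborel)
      = (\<integral>\<^sup>+t. (?e t p * indicator {0<..} t) * frac_kernel \<delta> \<tau> \<Omega> p \<partial>lborel)"
      by (simp add: mult_ac)
    also have "\<dots> = (\<integral>\<^sup>+t. ?e t p * indicator {0<..} t \<partial>lborel) * frac_kernel \<delta> \<tau> \<Omega> p"
      by (rule nn_integral_multc) measurable
    also have "\<dots> \<le> ennreal \<bar>h (snd p) - h (fst p)\<bar> * frac_kernel \<delta> \<tau> \<Omega> p"
      by (intro mult_right_mono nn_integral_abs_diff_levels) simp
    finally show "(\<integral>\<^sup>+t. ?e t p * frac_kernel \<delta> \<tau> \<Omega> p * indicator {0<..} t \<partial>lborel)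
      \<le> ennreal \<bar>h (snd p) - h (fst p)\<bar> * frac_kernel \<delta> \<tau> \<Omega> p" .
  qed
  also have "\<dots> = frac_energy \<delta> \<tau> h \<Omega>"
    by (rule frac_energy_eq_kernel[OF \<Omega> h, symmetric])
  also have "\<dots> = frac_energy \<delta> \<tau> g \<Omega>"
    by (rule frac_energy_cong) (simp add: h_def)
  finally show "(\<integral>\<^sup>+t\<in>{0<..}. frac_perimeter \<delta> \<tau> {x\<in>\<Omega>. t < g x} \<Omega> \<partial>lborel) \<le> frac_energy \<delta> \<tau> g \<Omega>" .
qed

text \<open>Tonelli's theorem applied to the region below the graph. Since \<open>ennreal\<close>
  sends negative reals to 0, the left side integrates the positive part of \<open>g\<close>; applied
  to \<open>f - m\<close> and \<open>m - f\<close> it yields the two halves of the distance from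
  \<open>f\<close> to \<open>m\<close>.\<close>

lemma nn_integral_layer_cake:
  fixes \<Omega> :: "'a::euclidean_space set"
  assumes \<Omega>: "open \<Omega>" and g: "set_borel_measurable lebesgue \<Omega> g"
  shows "(\<integral>\<^sup>+x\<in>\<Omega>. ennreal (g x) \<partial>lebesgue)
    = (\<integral>\<^sup>+t\<in>{0<..}. emeasure lebesgue {x\<in>\<Omega>. t < g x} \<partial>lborel)"
proof -
  define h where "h x = indicator \<Omega> x *\<^sub>R g x" for x
  have h[measurable]: "h \<in> borel_measurable lebesgue"
    using g unfolding h_def set_borel_measurable_def .
  have [measurable]: "\<Omega> \<in> sets lebesgue" using \<Omega> by simp
  have "(\<integral>\<^sup>+x\<in>\<Omega>. ennreal (g x) \<partial>lebesgue) = (\<integral>\<^sup>+x. ennreal (h x) \<partial>lebesgue)"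
    by (intro nn_integral_cong) (auto simp: h_def indicator_def)
  also have "\<dots> = (\<integral>\<^sup>+x. \<integral>\<^sup>+t. of_bool (0 < t \<and> t < h x) \<partial>lborel \<partial>lebesgue)"
  proof (rule nn_integral_cong)
    fix x
    have "(\<integral>\<^sup>+t. of_bool (0 < t \<and> t < h x) \<partial>lborel) = (\<integral>\<^sup>+t. indicator {0<..<h x} t \<partial>lborel)"
      by (intro nn_integral_cong) (auto simp: indicator_def)
    also have "\<dots> = ennreal (h x)"
      by (cases "0 \<le> h x") (auto simp: ennreal_neg)
    finally show "ennreal (h x) = (\<integral>\<^sup>+t. of_bool (0 < t \<and> t < h x) \<partial>lborel)" by simp
  qed
  also have "\<dots> = (\<integral>\<^sup>+t. \<integral>\<^sup>+x. of_bool (0 < t \<and> t < h x) \<partial>lebesgue \<partial>lborel)"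
    by (rule lborel_lebesgue.Fubini') measurable
  also have "\<dots> = (\<integral>\<^sup>+t\<in>{0<..}. emeasure lebesgue {x\<in>\<Omega>. t < g x} \<partial>lborel)"
  proof (rule nn_integral_cong)
    fix t :: real
    show "(\<integral>\<^sup>+x. of_bool (0 < t \<and> t < h x) \<partial>lebesgue) = emeasure lebesgue {x\<in>\<Omega>. t < g x} * indicator {0<..} t"
    proof (cases "0 < t")
      case True
      \<comment> \<open>At a positive level the zero extension contributes no points outside
        \<open>\<Omega>\<close>.\<close>
      then have eq: "{x\<in>\<Omega>. t < g x} = {x\<in>space lebesgue. t < h x}" by (auto simp: h_def indicator_def)
      have "(\<integral>\<^sup>+x. of_bool (0 < t \<and> t < h x) \<partial>lebesgue) = (\<integral>\<^sup>+x. indicator {x\<in>space lebesgue. t < h x} x \<partial>lebesgue)"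
        using True by (intro nn_integral_cong) (auto simp: indicator_def)
      also have "\<dots> = emeasure lebesgue {x\<in>space lebesgue. t < h x}"
        by (intro nn_integral_indicator) measurable
      finally show ?thesis using True eq by simp
    qed simp
  qed
  finally show ?thesis .
qed

subsection \<open>From perimeters to the Choquet integral\<close>

lemma is_lebesgue_value_minus_const:
  assumes "is_lebesgue_value f x a"
  shows "is_lebesgue_value (\<lambda>y. f y - c) x (a - c)"
  using assms by (simp add: is_lebesgue_value_def)

lemma is_lebesgue_value_const_minus:
  assumes "is_lebesgue_value f x a"
  shows "is_lebesgue_value (\<lambda>y. c - f y) x (c - a)"
  using assms by (simp add: is_lebesgue_value_def abs_minus_commute)

section \<open>Medians and their distance from the mean\<close>

lemma measure_lebesgue_open_pos:
  fixes \<Omega> :: "'a::euclidean_space set"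
  assumes "open \<Omega>" "bounded \<Omega>" "\<Omega> \<noteq> {}"
  shows "0 < measure lebesgue \<Omega>"
proof -
  obtain x r where r: "0 < r" "ball x r \<subseteq> \<Omega>"
    using assms by (metis ex_in_conv openE)
  have "0 < measure lebesgue (ball x r)" using r by (simp add: content_ball_gt_0_iff)
  also have "\<dots> \<le> measure lebesgue \<Omega>"
    using r assms by (intro measure_mono_fmeasurable) (auto simp: lmeasurable_open)
  finally show ?thesis .
qed

text \<open>The median is the infimum of the levels whose superlevel set has at most half the
  volume. Markov's inequality shows that the set of such levels is nonempty and bounded
  below.\<close>

lemma ex_median:
  fixes f :: "'a::euclidean_space \<Rightarrow> real"
  assumes \<Omega>: "open \<Omega>" "bounded \<Omega>" "\<Omega> \<noteq> {}" and f: "set_integrable lebesgue \<Omega> f"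
  obtains m where "\<And>t. 0 < t \<Longrightarrow> measure lebesgue {x\<in>\<Omega>. t < f x - m} \<le> measure lebesgue \<Omega> / 2"
    "\<And>t. 0 < t \<Longrightarrow> measure lebesgue {x\<in>\<Omega>. t < m - f x} \<le> measure lebesgue \<Omega> / 2"
proof -
  let ?M = "measure lebesgue \<Omega>"
  have \<Omega>m: "\<Omega> \<in> lmeasurable" using \<Omega> by (simp add: lmeasurable_open)
  have M: "0 < ?M" using \<Omega> by (rule measure_lebesgue_open_pos)
  have S[simp]: "{x\<in>\<Omega>. s < f x} \<in> sets lebesgue" for s
    using \<Omega>(1) f by (rule set_integrable_imp_sets_gt)
  have Sm: "{x\<in>\<Omega>. s < f x} \<in> lmeasurable" for s
    by (rule fmeasurableI2[OF \<Omega>m]) auto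
  define h where "h x = \<bar>indicator \<Omega> x *\<^sub>R f x\<bar>" for x
  have h: "integrable lebesgue h"
    using f unfolding h_def set_integrable_def by (rule integrable_abs)
  have h0: "0 \<le> (LINT x|lebesgue. h x)" by (simp add: h_def)
  \<comment> \<open>The summand 1 makes Markov's bound for \<open>c \<le> h x\<close> strictly
    smaller than half the volume, and keeps \<open>c\<close> positive.\<close>
  define c where "c = 2 * (LINT x|lebesgue. h x) / ?M + 1"
  have c: "0 < c" using h0 M by (simp add: c_def add_nonneg_pos)
  let ?A = "{x\<in>space lebesgue. c \<le> h x}"
  have Ale: "measure lebesgue ?A \<le> (LINT x|lebesgue. h x) / c"
    by (rule integral_Markov_inequality_measure[where A = "{}", OF h]) (use c in \<open>auto simp: h_def\<close>)
  also have "\<dots> < ?M / 2"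
    using c M by (simp add: c_def field_simps)
  finally have Alt: "measure lebesgue ?A < ?M / 2" .
  have hm[measurable]: "h \<in> borel_measurable lebesgue" using h by (rule borel_measurable_integrable)
  have Am: "?A \<in> lmeasurable"
  proof (rule fmeasurableI2[OF \<Omega>m])
    show "?A \<subseteq> \<Omega>" using c by (auto simp: h_def indicator_def split: if_splits)
  qed measurable
  define T where "T = {s. measure lebesgue {x\<in>\<Omega>. s < f x} \<le> ?M / 2}"
  have "c \<in> T"
  proof -
    have "measure lebesgue {x\<in>\<Omega>. c < f x} \<le> measure lebesgue ?A"
      by (rule measure_mono_fmeasurable) (use Am in \<open>auto simp: h_def\<close>)
    then show ?thesis using Alt by (simp add: T_def)
  qed
  have lb: "- c \<le> s" if s: "s \<in> T" for s
  proof (rule ccontr)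
    assume "\<not> - c \<le> s"
    \<comment> \<open>If \<open>s < - c\<close>, a point with \<open>f x \<le> s\<close> has
      \<open>\<bar>f x\<bar> \<ge> c\<close>. The two sets would cover \<open>\<Omega>\<close> with
      total volume below the volume of \<open>\<Omega>\<close>.\<close>
    then have "\<Omega> \<subseteq> {x\<in>\<Omega>. s < f x} \<union> ?A"
      by (auto simp: h_def)
    then have "?M \<le> measure lebesgue ({x\<in>\<Omega>. s < f x} \<union> ?A)"
      using \<Omega>m Am Sm by (intro measure_mono_fmeasurable) auto
    also have "\<dots> \<le> measure lebesgue {x\<in>\<Omega>. s < f x} + measure lebesgue ?A"
      using Am Sm by (intro measure_Un_le) auto
    finally show False using s Alt by (simp add: T_def)
  qed
  then have bdd: "bdd_below T" by (rule bdd_belowI)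
  define m where "m = Inf T"
  show thesis
  proof
    fix t :: real assume t: "0 < t"
    obtain s where s: "s \<in> T" "s < m + t"
      using cInf_lessD[of T "m + t"] \<open>c \<in> T\<close> t unfolding m_def by auto
    have "measure lebesgue {x\<in>\<Omega>. t < f x - m} \<le> measure lebesgue {x\<in>\<Omega>. s < f x}"
    proof (rule measure_mono_fmeasurable)
      have "{x\<in>\<Omega>. t < f x - m} = {x\<in>\<Omega>. m + t < f x}" by auto
      then show "{x\<in>\<Omega>. t < f x - m} \<in> sets lebesgue" by simp
    qed (use s Sm in auto)
    then show "measure lebesgue {x\<in>\<Omega>. t < f x - m} \<le> ?M / 2"
      using s by (simp add: T_def)
    \<comment> \<open>A level below the infimum has a superlevel set of more than half the volume;
      the complement bounds the sublevel set.\<close>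
    have "m - t \<notin> T"
      using cInf_lower[OF _ bdd, of "m - t"] t unfolding m_def by auto
    then have "?M / 2 < measure lebesgue {x\<in>\<Omega>. m - t < f x}" by (simp add: T_def)
    moreover have "measure lebesgue (\<Omega> - {x\<in>\<Omega>. m - t < f x}) = ?M - measure lebesgue {x\<in>\<Omega>. m - t < f x}"
      by (rule measurable_measure_Diff[OF \<Omega>m]) auto
    moreover have "measure lebesgue {x\<in>\<Omega>. t < m - f x} \<le> measure lebesgue (\<Omega> - {x\<in>\<Omega>. m - t < f x})"
    proof (rule measure_mono_fmeasurable)
      have "set_integrable lebesgue \<Omega> (\<lambda>x. - f x)"
        using f by (simp add: set_integrable_def)
      from set_integrable_imp_sets_gt[OF \<Omega>(1) this, of "t - m"]
      have "{x\<in>\<Omega>. t - m < - f x} \<in> sets lebesgue" .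
      moreover have "{x\<in>\<Omega>. t - m < - f x} = {x\<in>\<Omega>. t < m - f x}" by auto
      ultimately show "{x\<in>\<Omega>. t < m - f x} \<in> sets lebesgue" by simp
    qed (use \<Omega>m S in \<open>auto intro: fmeasurable_Diff\<close>)
    ultimately show "measure lebesgue {x\<in>\<Omega>. t < m - f x} \<le> ?M / 2" by simp
  qed
qed

lemma abs_mean_value_diff_le:
  fixes f :: "'a::euclidean_space \<Rightarrow> real"
  assumes \<Omega>: "open \<Omega>" "bounded \<Omega>" "\<Omega> \<noteq> {}" and f: "set_integrable lebesgue \<Omega> f"
  shows "ennreal (\<bar>mean_value \<Omega> f - m\<bar> * measure lebesgue \<Omega>)
    \<le> (\<integral>\<^sup>+x\<in>\<Omega>. ennreal (f x - m) \<partial>lebesgue) + (\<integral>\<^sup>+x\<in>\<Omega>. ennreal (m - f x) \<partial>lebesgue)"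
proof -
  let ?M = "measure lebesgue \<Omega>"
  have M: "0 < ?M" using \<Omega> by (rule measure_lebesgue_open_pos)
  have \<Omega>m: "\<Omega> \<in> lmeasurable" using \<Omega> by (simp add: lmeasurable_open)
  have const: "set_integrable lebesgue \<Omega> (\<lambda>_. m)"
    using \<Omega>m by (simp add: set_integrable_def lmeasurable_iff_integrable)
  have [measurable]: "\<Omega> \<in> sets lebesgue" using \<Omega> by simp
  define h where "h x = indicator \<Omega> x *\<^sub>R (f x - m)" for x
  have h: "integrable lebesgue h"
    using set_integral_diff(1)[OF f const] by (simp add: set_integrable_def h_def[abs_def])
  have hm[measurable]: "h \<in> borel_measurable lebesgue" using h by (rule borel_measurable_integrable)
  have "(LINT x|lebesgue. h x) = (LINT x:\<Omega>|lebesgue. f x) - (LINT x:\<Omega>|lebesgue. m)"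
    using set_integral_diff(2)[OF f const] by (simp add: set_lebesgue_integral_def h_def)
  also have "\<dots> = (mean_value \<Omega> f - m) * ?M"
    using M by (simp add: set_lebesgue_integral_def mean_value_def field_simps)
  finally have "\<bar>mean_value \<Omega> f - m\<bar> * ?M = \<bar>LINT x|lebesgue. h x\<bar>"
    using M by (simp add: abs_mult)
  also have "\<dots> \<le> (LINT x|lebesgue. \<bar>h x\<bar>)"
    by (rule integral_abs_bound)
  finally have "ennreal (\<bar>mean_value \<Omega> f - m\<bar> * ?M) \<le> ennreal (LINT x|lebesgue. \<bar>h x\<bar>)"
    by (rule ennreal_leI)
  also have "\<dots> = (\<integral>\<^sup>+x. ennreal \<bar>h x\<bar> \<partial>lebesgue)"
    using h by (intro nn_integral_eq_integral[symmetric]) auto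
  also have "\<dots> = (\<integral>\<^sup>+x. ennreal (h x) + ennreal (- h x) \<partial>lebesgue)"
    by (intro nn_integral_cong) (auto simp: abs_if ennreal_neg)
  also have "\<dots> = (\<integral>\<^sup>+x. ennreal (h x) \<partial>lebesgue) + (\<integral>\<^sup>+x. ennreal (- h x) \<partial>lebesgue)"
    by (intro nn_integral_add) measurable
  also have "(\<integral>\<^sup>+x. ennreal (h x) \<partial>lebesgue) = (\<integral>\<^sup>+x\<in>\<Omega>. ennreal (f x - m) \<partial>lebesgue)"
    by (intro nn_integral_cong) (auto simp: h_def indicator_def)
  also have "(\<integral>\<^sup>+x. ennreal (- h x) \<partial>lebesgue) = (\<integral>\<^sup>+x\<in>\<Omega>. ennreal (m - f x) \<partial>lebesgue)"
    by (intro nn_integral_cong) (auto simp: h_def indicator_def)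
  finally show ?thesis .
qed

text \<open>Replaces the reference value \<open>m\<close> by \<open>q\<close>. If
  \<open>t > 2 * \<bar>q - m\<bar>\<close>, a deviation above \<open>t\<close> from \<open>q\<close>
  forces one above \<open>t / 2\<close> from \<open>m\<close>; smaller \<open>t\<close> are charged
  the content of \<open>\<Omega>\<close>. Substituting \<open>t / 2\<close> produces the factor
  2.\<close>

lemma choquet_integral_le_of_level_bound:
  fixes \<Omega> :: "'a::euclidean_space set" and f :: "'a \<Rightarrow> real" and F :: "real \<Rightarrow> ennreal"
  assumes \<Omega>: "open \<Omega>" and f: "set_integrable lebesgue \<Omega> f"
    and F[measurable]: "F \<in> borel_measurable borel"
    and le: "\<And>t. 0 < t \<Longrightarrow> hausdorff_content \<beta> {x\<in>\<Omega>. \<exists>a. t < \<bar>a - m\<bar> \<and> is_lebesgue_value f x a} \<le> F t"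
  shows "choquet_integral \<beta> (lebesgue_points \<Omega> f) (\<lambda>x. precise_rep f x - q)
    \<le> 2 * (\<integral>\<^sup>+t\<in>{0<..}. F t \<partial>lborel) + ennreal (2 * \<bar>q - m\<bar>) * hausdorff_content \<beta> \<Omega>"
proof -
  define G where "G t = F t * indicator {0<..} t" for t
  have G[measurable]: "G \<in> borel_measurable borel" unfolding G_def by measurable
  have pw: "hausdorff_content \<beta> {x\<in>lebesgue_points \<Omega> f. \<bar>precise_rep f x - q\<bar> > t} * indicator {0<..} t
      \<le> G (0 + (1/2) * t) + hausdorff_content \<beta> \<Omega> * indicator {0..2 * \<bar>q - m\<bar>} t" for t
  proof (cases "0 < t")
    case t: True
    show ?thesis
    proof (cases "t \<le> 2 * \<bar>q - m\<bar>")
      case True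
      have "hausdorff_content \<beta> {x\<in>lebesgue_points \<Omega> f. \<bar>precise_rep f x - q\<bar> > t} \<le> hausdorff_content \<beta> \<Omega>"
        by (rule hausdorff_content_mono) (auto simp: lebesgue_points_def)
      then show ?thesis using t True by (simp add: add_increasing)
    next
      case False
      have "hausdorff_content \<beta> {x\<in>lebesgue_points \<Omega> f. \<bar>precise_rep f x - q\<bar> > t}
        \<le> hausdorff_content \<beta> {x\<in>\<Omega>. \<exists>a. t / 2 < \<bar>a - m\<bar> \<and> is_lebesgue_value f x a}"
      proof (rule hausdorff_content_mono, rule subsetI)
        fix x assume x: "x \<in> {x\<in>lebesgue_points \<Omega> f. \<bar>precise_rep f x - q\<bar> > t}"
        then have "is_lebesgue_value f x (precise_rep f x)"
          using \<Omega> f by (intro lebesgue_points_precise_rep) auto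
        moreover have "t / 2 < \<bar>precise_rep f x - m\<bar>"
        proof -
          have "\<bar>precise_rep f x - q\<bar> \<le> \<bar>precise_rep f x - m\<bar> + \<bar>q - m\<bar>" by linarith
          then show ?thesis using x False by simp
        qed
        ultimately show "x \<in> {x\<in>\<Omega>. \<exists>a. t / 2 < \<bar>a - m\<bar> \<and> is_lebesgue_value f x a}"
          using x by (auto simp: lebesgue_points_def)
      qed
      also have "\<dots> \<le> F (t / 2)" using t by (intro le) simp
      finally show ?thesis using t by (simp add: G_def add_increasing2)
    qed
  qed simp
  have "choquet_integral \<beta> (lebesgue_points \<Omega> f) (\<lambda>x. precise_rep f x - q)
    \<le> (\<integral>\<^sup>+t. G (0 + (1/2) * t) + hausdorff_content \<beta> \<Omega> * indicator {0..2 * \<bar>q - m\<bar>} t \<partial>lborel)"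
    unfolding choquet_integral_def by (intro nn_integral_mono pw)
  also have "\<dots> = (\<integral>\<^sup>+t. G (0 + (1/2) * t) \<partial>lborel)
      + (\<integral>\<^sup>+t. hausdorff_content \<beta> \<Omega> * indicator {0..2 * \<bar>q - m\<bar>} t \<partial>lborel)"
    by (rule nn_integral_add) measurable
  also have "(\<integral>\<^sup>+t. hausdorff_content \<beta> \<Omega> * indicator {0..2 * \<bar>q - m\<bar>} t \<partial>lborel)
    = ennreal (2 * \<bar>q - m\<bar>) * hausdorff_content \<beta> \<Omega>"
    by (subst nn_integral_cmult_indicator) (auto simp: mult.commute)
  also have "(\<integral>\<^sup>+t. G (0 + (1/2) * t) \<partial>lborel) = 2 * (\<integral>\<^sup>+t. G t \<partial>lborel)"
  proof -
    have "(\<integral>\<^sup>+t. G t \<partial>lborel) = ennreal (1/2) * (\<integral>\<^sup>+t. G (0 + (1/2) * t) \<partial>lborel)"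
      using nn_integral_real_affine[OF G, of "1/2" 0] by simp
    moreover have "2 * ennreal (1/2) = 1"
      by (metis ennreal_1 ennreal_mult ennreal_numeral mult_2 field_sum_of_halves zero_le_numeral zero_le_divide_1_iff)
    ultimately show ?thesis by (simp add: mult.assoc[symmetric])
  qed
  finally show ?thesis by (simp add: G_def)
qed

text \<open>\<open>K\<close> is chosen before \<open>B\<close>, \<open>\<delta>\<close>,
  \<open>\<tau>\<close> and \<open>f\<close>, so it depends only on \<open>\<Omega>\<close> and
  \<open>\<beta>\<close>. With \<open>B = C * (1 - \<delta>)\<close> this preserves independence of
  \<open>\<delta>\<close>.\<close>

lemma perimeter_bound_imp_choquet_bound:
  fixes \<Omega> :: "'a::euclidean_space set" and \<beta> :: real
  assumes \<Omega>: "open \<Omega>" "bounded \<Omega>" "\<Omega> \<noteq> {}" and \<beta>: "0 < \<beta>" "\<beta> \<le> DIM('a)"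
  shows "\<exists>K>0. \<forall>B\<ge>0. \<forall>\<delta> \<tau> f. set_integrable lebesgue \<Omega> f \<longrightarrow>
      (\<forall>U\<in>sets lebesgue. U \<subseteq> \<Omega> \<and> measure lebesgue U / measure lebesgue \<Omega> \<le> 1 / 2 \<longrightarrow>
        (\<exists>N\<in>null_sets lebesgue. hausdorff_content \<beta> (U - N) \<le> ennreal B * frac_perimeter \<delta> \<tau> U \<Omega>)) \<longrightarrow>
    choquet_integral \<beta> (lebesgue_points \<Omega> f) (\<lambda>x. precise_rep f x - mean_value \<Omega> f)
      \<le> ennreal (K * B) * frac_energy \<delta> \<tau> f \<Omega>"
proof -
  let ?M = "measure lebesgue \<Omega>"
  have M: "0 < ?M" using \<Omega> by (rule measure_lebesgue_open_pos)
  have \<Omega>s: "\<Omega> \<in> sets lebesgue" using \<Omega> by simp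
  obtain k where k: "0 < k" "\<And>A N. \<lbrakk>A \<in> sets lebesgue; A \<subseteq> \<Omega>; N \<in> null_sets lebesgue\<rbrakk>
    \<Longrightarrow> emeasure lebesgue A \<le> ennreal k * hausdorff_content \<beta> (A - N)"
    using emeasure_le_hausdorff_content[OF \<Omega>(2) \<Omega>s \<beta>] by blast
  define d where "d = 2 powr \<beta> + 2 * 10 powr \<beta>"
  have d: "0 < d" unfolding d_def by (intro add_pos_pos) auto
  obtain H where H: "0 \<le> H" "hausdorff_content \<beta> \<Omega> = ennreal H"
    using hausdorff_content_bounded_finite[OF \<Omega>(2), of \<beta>] by (cases "hausdorff_content \<beta> \<Omega>") auto
  \<comment> \<open>The first term is \<open>d\<close> times 2 for the substitution and 2 for using
    both super- and sublevel sets. The second is \<open>2 * H\<close> times the bound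
    \<open>2 * k / ?M\<close> for the distance from mean to median, per unit of \<open>B\<close> and
    energy.\<close>
  define K where "K = 4 * d + 4 * k * H / ?M"
  have K: "0 < K" unfolding K_def using d k H M by (intro add_pos_nonneg) auto
  have "choquet_integral \<beta> (lebesgue_points \<Omega> f) (\<lambda>x. precise_rep f x - mean_value \<Omega> f)
      \<le> ennreal (K * B) * frac_energy \<delta> \<tau> f \<Omega>"
    if B: "0 \<le> B" and f: "set_integrable lebesgue \<Omega> f"
      and per: "\<forall>U\<in>sets lebesgue. U \<subseteq> \<Omega> \<and> measure lebesgue U / measure lebesgue \<Omega> \<le> 1 / 2 \<longrightarrow>
        (\<exists>N\<in>null_sets lebesgue. hausdorff_content \<beta> (U - N) \<le> ennreal B * frac_perimeter \<delta> \<tau> U \<Omega>)"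
    for B \<delta> \<tau> f
  proof -
    let ?E = "frac_energy \<delta> \<tau> f \<Omega>"
    obtain m where m: "\<And>t. 0 < t \<Longrightarrow> measure lebesgue {x\<in>\<Omega>. t < f x - m} \<le> ?M / 2"
        "\<And>t. 0 < t \<Longrightarrow> measure lebesgue {x\<in>\<Omega>. t < m - f x} \<le> ?M / 2"
      using ex_median[OF \<Omega> f] by blast
    let ?P = "\<lambda>g t. frac_perimeter \<delta> \<tau> {x\<in>\<Omega>. t < g x} \<Omega>"
    \<comment> \<open>The same \<open>N\<close> serves twice: the content bound feeds the Choquet
      integral, the volume bound feeds the distance between mean and median.\<close>
    have level: "hausdorff_content \<beta> {x\<in>\<Omega>. \<exists>a. t < a \<and> is_lebesgue_value g x a} \<le> ennreal (d * B) * ?P g t"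
        "emeasure lebesgue {x\<in>\<Omega>. t < g x} \<le> ennreal (k * B) * ?P g t"
      if g: "set_integrable lebesgue \<Omega> g" and half: "measure lebesgue {x\<in>\<Omega>. t < g x} \<le> ?M / 2" for g t
    proof -
      let ?U = "{x\<in>\<Omega>. t < g x}"
      have U: "?U \<in> sets lebesgue" using \<Omega>(1) g by (rule set_integrable_imp_sets_gt)
      have "measure lebesgue ?U / ?M \<le> 1 / 2" using half M by (simp add: field_simps)
      then obtain N where N: "N \<in> null_sets lebesgue"
          "hausdorff_content \<beta> (?U - N) \<le> ennreal B * ?P g t"
        using per[THEN bspec, OF U] by auto
      have "hausdorff_content \<beta> {x\<in>\<Omega>. \<exists>a. t < a \<and> is_lebesgue_value g x a}
        \<le> hausdorff_content \<beta> {x. \<exists>r. 0 < r \<and> r \<le> 1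
            \<and> emeasure lebesgue (ball x r) \<le> 2 * emeasure lebesgue (?U \<inter> ball x r)}"
      proof (rule hausdorff_content_mono, rule subsetI)
        fix x assume "x \<in> {x\<in>\<Omega>. \<exists>a. t < a \<and> is_lebesgue_value g x a}"
        then obtain a where "x \<in> \<Omega>" "t < a" "is_lebesgue_value g x a" by auto
        from is_lebesgue_value_half_ball[OF \<Omega>(1) this(1) g this(3,2)]
        show "x \<in> {x. \<exists>r. 0 < r \<and> r \<le> 1
            \<and> emeasure lebesgue (ball x r) \<le> 2 * emeasure lebesgue (?U \<inter> ball x r)}" by (rule CollectI)
      qed
      also have "\<dots> \<le> ennreal d * hausdorff_content \<beta> (?U - N)"
        unfolding d_def by (rule hausdorff_content_density_set_le[OF U N(1) \<beta>])
      also have "\<dots> \<le> ennreal d * (ennreal B * ?P g t)"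
        using N(2) by (rule mult_left_mono) simp
      finally show "hausdorff_content \<beta> {x\<in>\<Omega>. \<exists>a. t < a \<and> is_lebesgue_value g x a} \<le> ennreal (d * B) * ?P g t"
        using d B by (simp add: ennreal_mult mult.assoc)
      have "emeasure lebesgue ?U \<le> ennreal k * hausdorff_content \<beta> (?U - N)"
        using U N by (intro k) auto
      also have "\<dots> \<le> ennreal k * (ennreal B * ?P g t)"
        using N(2) by (rule mult_left_mono) simp
      finally show "emeasure lebesgue ?U \<le> ennreal (k * B) * ?P g t"
        using k(1) B by (simp add: ennreal_mult mult.assoc)
    qed
    have \<Omega>m: "\<Omega> \<in> lmeasurable" using \<Omega> by (simp add: lmeasurable_open)
    have const: "set_integrable lebesgue \<Omega> (\<lambda>_. m)"
      using \<Omega>m by (simp add: set_integrable_def lmeasurable_iff_integrable)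
    let ?g1 = "\<lambda>x. f x - m" and ?g2 = "\<lambda>x. m - f x"
    have g1: "set_integrable lebesgue \<Omega> ?g1"
      by (rule set_integral_diff(1)[OF f const])
    have g2: "set_integrable lebesgue \<Omega> ?g2"
      by (rule set_integral_diff(1)[OF const f])
    have bm: "set_borel_measurable lebesgue \<Omega> g" if "set_integrable lebesgue \<Omega> g" for g :: "'a \<Rightarrow> real"
      using that unfolding set_integrable_def set_borel_measurable_def by (rule borel_measurable_integrable)
    note [measurable] = frac_perimeter_superlevel_measurable[OF \<Omega>(1) bm[OF g1], of \<delta> \<tau>]
      frac_perimeter_superlevel_measurable[OF \<Omega>(1) bm[OF g2], of \<delta> \<tau>]
    \<comment> \<open>Subtracting a constant or changing the sign leaves all differences
      \<open>\<bar>f x - f y\<bar>\<close> unchanged, so both level families are paid for by the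
      energy of \<open>f\<close>.\<close>
    have P1: "(\<integral>\<^sup>+t\<in>{0<..}. ?P ?g1 t \<partial>lborel) \<le> ?E"
      using nn_integral_frac_perimeter_le[OF \<Omega>(1) bm[OF g1]] frac_energy_mono[of \<Omega> ?g1 f]
      by (rule order_trans) simp
    have P2: "(\<integral>\<^sup>+t\<in>{0<..}. ?P ?g2 t \<partial>lborel) \<le> ?E"
      using nn_integral_frac_perimeter_le[OF \<Omega>(1) bm[OF g2]] frac_energy_mono[of \<Omega> ?g2 f]
      by (rule order_trans) (simp add: abs_minus_commute)
    have sum_le: "(\<integral>\<^sup>+t\<in>{0<..}. ennreal c * ?P ?g1 t + ennreal c * ?P ?g2 t \<partial>lborel) \<le> ennreal (2 * c) * ?E"
      if "0 \<le> c" for c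
    proof -
      have "(\<integral>\<^sup>+t\<in>{0<..}. ennreal c * ?P ?g1 t + ennreal c * ?P ?g2 t \<partial>lborel)
        = ennreal c * (\<integral>\<^sup>+t\<in>{0<..}. ?P ?g1 t \<partial>lborel) + ennreal c * (\<integral>\<^sup>+t\<in>{0<..}. ?P ?g2 t \<partial>lborel)"
        by (simp add: distrib_right mult.assoc nn_integral_add nn_integral_cmult)
      also have "\<dots> \<le> ennreal c * ?E + ennreal c * ?E"
        by (intro add_mono mult_left_mono P1 P2) auto
      also have "\<dots> = 2 * ennreal c * ?E"
        by (simp only: mult_2 distrib_right)
      also have "2 * ennreal c = ennreal (2 * c)"
        using that by (simp add: ennreal_mult)
      finally show ?thesis .
    qed

    have "ennreal (\<bar>mean_value \<Omega> f - m\<bar> * ?M)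
      \<le> (\<integral>\<^sup>+x\<in>\<Omega>. ennreal (f x - m) \<partial>lebesgue) + (\<integral>\<^sup>+x\<in>\<Omega>. ennreal (m - f x) \<partial>lebesgue)"
      by (rule abs_mean_value_diff_le[OF \<Omega> f])
    also have "\<dots> = (\<integral>\<^sup>+t\<in>{0<..}. emeasure lebesgue {x\<in>\<Omega>. t < f x - m} \<partial>lborel)
        + (\<integral>\<^sup>+t\<in>{0<..}. emeasure lebesgue {x\<in>\<Omega>. t < m - f x} \<partial>lborel)"
      by (simp only: nn_integral_layer_cake[OF \<Omega>(1) bm[OF g1]] nn_integral_layer_cake[OF \<Omega>(1) bm[OF g2]])
    also have "\<dots> \<le> (\<integral>\<^sup>+t\<in>{0<..}. ennreal (k * B) * ?P ?g1 t \<partial>lborel)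
        + (\<integral>\<^sup>+t\<in>{0<..}. ennreal (k * B) * ?P ?g2 t \<partial>lborel)"
      using level(2)[OF g1 m(1)] level(2)[OF g2 m(2)]
      by (intro add_mono nn_integral_mono) (auto simp: indicator_def simp del: emeasure_completion)
    also have "\<dots> = (\<integral>\<^sup>+t\<in>{0<..}. ennreal (k * B) * ?P ?g1 t + ennreal (k * B) * ?P ?g2 t \<partial>lborel)"
      by (simp add: distrib_right nn_integral_add)
    also have "\<dots> \<le> ennreal (2 * (k * B)) * ?E"
      using k(1) B by (intro sum_le) simp
    finally have mean: "ennreal (\<bar>mean_value \<Omega> f - m\<bar> * ?M) \<le> ennreal (2 * (k * B)) * ?E" .

    have "choquet_integral \<beta> (lebesgue_points \<Omega> f) (\<lambda>x. precise_rep f x - mean_value \<Omega> f)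
      \<le> 2 * (\<integral>\<^sup>+t\<in>{0<..}. ennreal (d * B) * ?P ?g1 t + ennreal (d * B) * ?P ?g2 t \<partial>lborel)
        + ennreal (2 * \<bar>mean_value \<Omega> f - m\<bar>) * hausdorff_content \<beta> \<Omega>"
    proof (rule choquet_integral_le_of_level_bound[OF \<Omega>(1) f])
      fix t :: real assume t: "0 < t"
      have "hausdorff_content \<beta> {x\<in>\<Omega>. \<exists>a. t < \<bar>a - m\<bar> \<and> is_lebesgue_value f x a}
        \<le> hausdorff_content \<beta> ({x\<in>\<Omega>. \<exists>a. t < a \<and> is_lebesgue_value ?g1 x a}
            \<union> {x\<in>\<Omega>. \<exists>a. t < a \<and> is_lebesgue_value ?g2 x a})"
      proof (rule hausdorff_content_mono, rule subsetI)
        fix x assume "x \<in> {x\<in>\<Omega>. \<exists>a. t < \<bar>a - m\<bar> \<and> is_lebesgue_value f x a}"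
        then obtain a where a: "x \<in> \<Omega>" "t < \<bar>a - m\<bar>" "is_lebesgue_value f x a" by auto
        then consider "t < a - m" | "t < m - a" by linarith
        then show "x \<in> {x\<in>\<Omega>. \<exists>a. t < a \<and> is_lebesgue_value ?g1 x a}
            \<union> {x\<in>\<Omega>. \<exists>a. t < a \<and> is_lebesgue_value ?g2 x a}"
          using a is_lebesgue_value_minus_const[OF a(3), of m] is_lebesgue_value_const_minus[OF a(3), of m]
          by cases blast+
      qed
      also have "\<dots> \<le> hausdorff_content \<beta> {x\<in>\<Omega>. \<exists>a. t < a \<and> is_lebesgue_value ?g1 x a}
          + hausdorff_content \<beta> {x\<in>\<Omega>. \<exists>a. t < a \<and> is_lebesgue_value ?g2 x a}"
        by (rule hausdorff_content_Un_le)
      also have "\<dots> \<le> ennreal (d * B) * ?P ?g1 t + ennreal (d * B) * ?P ?g2 t"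
        using t by (intro add_mono level g1 g2 m)
      finally show "hausdorff_content \<beta> {x\<in>\<Omega>. \<exists>a. t < \<bar>a - m\<bar> \<and> is_lebesgue_value f x a}
        \<le> ennreal (d * B) * ?P ?g1 t + ennreal (d * B) * ?P ?g2 t" .
    qed measurable
    also have "\<dots> \<le> ennreal (4 * d * B) * ?E + ennreal (4 * k * H / ?M * B) * ?E"
    proof (rule add_mono)
      have merge: "ennreal p * (ennreal q * ?E) = ennreal (p * q) * ?E" if "0 \<le> p" "0 \<le> q" for p q
        using that by (simp add: ennreal_mult mult.assoc)
      have "(\<integral>\<^sup>+t\<in>{0<..}. ennreal (d * B) * ?P ?g1 t + ennreal (d * B) * ?P ?g2 t \<partial>lborel)
        \<le> ennreal (2 * (d * B)) * ?E"
        using d B by (intro sum_le) simp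
      then have "ennreal 2 * (\<integral>\<^sup>+t\<in>{0<..}. ennreal (d * B) * ?P ?g1 t + ennreal (d * B) * ?P ?g2 t \<partial>lborel)
        \<le> ennreal 2 * (ennreal (2 * (d * B)) * ?E)"
        by (rule mult_left_mono) simp
      also have "\<dots> = ennreal (4 * d * B) * ?E"
        using d B by (subst merge) (simp_all add: mult.assoc)
      finally show "2 * (\<integral>\<^sup>+t\<in>{0<..}. ennreal (d * B) * ?P ?g1 t + ennreal (d * B) * ?P ?g2 t \<partial>lborel)
        \<le> ennreal (4 * d * B) * ?E"
        by simp
      have "ennreal (2 * \<bar>mean_value \<Omega> f - m\<bar>) * hausdorff_content \<beta> \<Omega>
        = ennreal (2 * \<bar>mean_value \<Omega> f - m\<bar> * H)"
        using H by (simp add: ennreal_mult)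
      also have "2 * \<bar>mean_value \<Omega> f - m\<bar> * H = 2 * H / ?M * (\<bar>mean_value \<Omega> f - m\<bar> * ?M)"
        using M by simp
      also have "ennreal \<dots> = ennreal (2 * H / ?M) * ennreal (\<bar>mean_value \<Omega> f - m\<bar> * ?M)"
        using H(1) M by (intro ennreal_mult) auto
      also have "\<dots> \<le> ennreal (2 * H / ?M) * (ennreal (2 * (k * B)) * ?E)"
        using mean by (rule mult_left_mono) simp
      also have "\<dots> = ennreal (2 * H / ?M * (2 * (k * B))) * ?E"
        using H(1) M k(1) B by (intro merge) auto
      also have "2 * H / ?M * (2 * (k * B)) = 4 * k * H / ?M * B"
        by simp
      finally show "ennreal (2 * \<bar>mean_value \<Omega> f - m\<bar>) * hausdorff_content \<beta> \<Omega>
        \<le> ennreal (4 * k * H / ?M * B) * ?E" .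
    qed
    also have "\<dots> = (ennreal (4 * d * B) + ennreal (4 * k * H / ?M * B)) * ?E"
      by (rule distrib_right[symmetric])
    also have "ennreal (4 * d * B) + ennreal (4 * k * H / ?M * B) = ennreal (K * B)"
      using H(1) M k(1) B d by (subst ennreal_plus[symmetric]) (auto simp: K_def distrib_right)
    finally show ?thesis .
  qed
  with K show ?thesis by (intro exI[of _ K] conjI allI impI) auto
qed

section \<open>From the Choquet inequality back to perimeters\<close>

lemma set_integrable_indicator_bounded:
  fixes \<Omega> U :: "'a::euclidean_space set"
  assumes "bounded \<Omega>" "U \<in> sets lebesgue" "U \<subseteq> \<Omega>"
  shows "set_integrable lebesgue \<Omega> (indicat_real U)"
proof -
  have "U \<in> lmeasurable"
    using assms by (meson bounded_set_imp_lmeasurable bounded_subset)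
  moreover have "(\<lambda>x. indicator \<Omega> x *\<^sub>R indicator U x) = indicat_real U"
    using assms(3) by (auto simp: fun_eq_iff indicator_def)
  ultimately show ?thesis
    by (simp add: set_integrable_def lmeasurable_iff_integrable)
qed

text \<open>At density points of \<open>U\<close> the precise representative is 1 while the mean is
  at most \<open>\<gamma>\<close>. Hence every level \<open>t\<close> in
  \<open>(0, 1 - \<gamma>)\<close> contributes at least the content of the density points to the
  Choquet integral.\<close>

lemma content_le_choquet_indicator:
  fixes \<Omega> U :: "'a::euclidean_space set"
  assumes \<Omega>: "open \<Omega>" "bounded \<Omega>" "\<Omega> \<noteq> {}" and U: "U \<in> sets lebesgue" "U \<subseteq> \<Omega>"
    and \<gamma>: "measure lebesgue U / measure lebesgue \<Omega> \<le> \<gamma>" "\<gamma> < 1"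
  shows "ennreal (1 - \<gamma>) * hausdorff_content \<beta> {x\<in>U. is_lebesgue_value (indicator U) x 1}
    \<le> choquet_integral \<beta> (lebesgue_points \<Omega> (indicator U)) (\<lambda>x. precise_rep (indicator U) x - mean_value \<Omega> (indicator U))"
proof -
  let ?D = "{x\<in>U. is_lebesgue_value (indicator U) x 1}"
  have ind: "(\<lambda>x. indicator \<Omega> x *\<^sub>R indicator U x) = indicat_real U"
    using U by (auto simp: fun_eq_iff indicator_def)
  have f: "set_integrable lebesgue \<Omega> (indicat_real U)"
    by (rule set_integrable_indicator_bounded[OF \<Omega>(2) U])
  have mean: "mean_value \<Omega> (indicat_real U) = measure lebesgue U / measure lebesgue \<Omega>"
    unfolding mean_value_def set_lebesgue_integral_def ind by simp
  have "ennreal (1 - \<gamma>) * hausdorff_content \<beta> ?D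
    = (\<integral>\<^sup>+t. hausdorff_content \<beta> ?D * indicator {0<..<1 - \<gamma>} t \<partial>lborel)"
    using \<gamma> by (subst nn_integral_cmult_indicator) (auto simp: mult.commute)
  also have "\<dots> \<le> choquet_integral \<beta> (lebesgue_points \<Omega> (indicator U))
      (\<lambda>x. precise_rep (indicator U) x - mean_value \<Omega> (indicator U))"
    unfolding choquet_integral_def
  proof (rule nn_integral_mono)
    fix t :: real
    have "hausdorff_content \<beta> ?D \<le> hausdorff_content \<beta>
        {x\<in>lebesgue_points \<Omega> (indicator U). \<bar>precise_rep (indicator U) x - mean_value \<Omega> (indicator U)\<bar> > t}"
      if t: "t < 1 - \<gamma>"
    proof (rule hausdorff_content_mono, rule subsetI)
      fix x assume x: "x \<in> ?D"
      then have "precise_rep (indicat_real U) x = 1"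
        using \<Omega> U f by (intro precise_rep_eq[of \<Omega>]) auto
      then show "x \<in> {x\<in>lebesgue_points \<Omega> (indicator U).
          \<bar>precise_rep (indicator U) x - mean_value \<Omega> (indicator U)\<bar> > t}"
        using x U t \<gamma> by (auto simp: lebesgue_points_def mean)
    qed
    then show "hausdorff_content \<beta> ?D * indicator {0<..<1 - \<gamma>} t \<le> hausdorff_content \<beta>
        {x\<in>lebesgue_points \<Omega> (indicator U). \<bar>precise_rep (indicator U) x - mean_value \<Omega> (indicator U)\<bar> > t}
        * indicator {0<..} t"
      by (auto simp: indicator_def)
  qed
  finally show ?thesis .
qed

theorem proposition6p1:
  fixes \<Omega> :: "(real ^ 'n) set" and \<tau> \<beta> :: real and \<Delta> :: "real set"
  assumes "CARD('n) \<ge> 2"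
    and "open \<Omega>" and "connected \<Omega>" and "\<Omega> \<noteq> {}" and "bounded \<Omega>"
    and "0 < \<tau>" and "\<tau> < 1"
    and "\<Delta> \<noteq> {}" and "\<Delta> \<subseteq> {0<..<1}"
    and "\<And>\<delta>. \<delta> \<in> \<Delta> \<Longrightarrow> real CARD('n) - \<delta> \<le> \<beta>" and "\<beta> \<le> real CARD('n)"
  shows
    "(\<forall>\<gamma>. 0 < \<gamma> \<and> \<gamma> < 1 \<longrightarrow>
        (\<exists>C>0. \<forall>\<delta>\<in>\<Delta>. \<forall>U. U \<in> sets lebesgue \<and> U \<subseteq> \<Omega> \<and>
            measure lebesgue U / measure lebesgue \<Omega> \<le> \<gamma> \<longrightarrow>
          (\<exists>N. N \<in> null_sets lebesgue \<and>
             hausdorff_content \<beta> (U - N) \<le> ennreal (C * (1 - \<delta>)) * frac_perimeter \<delta> \<tau> U \<Omega>) \<and>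
          (open U \<longrightarrow>
             hausdorff_content \<beta> U \<le> ennreal (C * (1 - \<delta>)) * frac_perimeter \<delta> \<tau> U \<Omega>)))
     \<longleftrightarrow>
     (\<exists>C>0. \<forall>\<delta>\<in>\<Delta>. \<forall>f :: real ^ 'n \<Rightarrow> real. set_integrable lebesgue \<Omega> f \<longrightarrow>
        choquet_integral \<beta> (lebesgue_points \<Omega> f) (\<lambda>x. precise_rep f x - mean_value \<Omega> f)
          \<le> ennreal (C * (1 - \<delta>)) * frac_energy \<delta> \<tau> f \<Omega>)"
proof -
  \<comment> \<open>One admissible exponent suffices for positivity:
    \<open>\<beta> \<ge> n - \<delta>0 > 1\<close>, because \<open>n \<ge> 2\<close> and
    \<open>\<delta>0 < 1\<close>.\<close>
  obtain \<delta>0 where "\<delta>0 \<in> \<Delta>" using assms(8) by blast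
  then have \<beta>: "0 < \<beta>" "\<beta> \<le> real DIM(real ^ 'n)"
    using assms(1,9,11) assms(10)[of \<delta>0] by (auto simp: subset_iff)
  have \<delta>1: "\<delta> < 1" if "\<delta> \<in> \<Delta>" for \<delta> using assms(9) that by auto
  note \<Omega> = assms(2,5,4)
  show ?thesis (is "?perimeter \<longleftrightarrow> ?choquet")
  proof
    assume per: ?perimeter
    \<comment> \<open>Only \<open>\<gamma> = 1/2\<close> is used, since level sets on either side of
      a median fill at most half of \<open>\<Omega>\<close>.\<close>
    have half: "0 < (1 / 2 :: real) \<and> (1 / 2 :: real) < 1" by simp
    obtain C where C: "0 < C" and level: "\<forall>\<delta>\<in>\<Delta>. \<forall>U. U \<in> sets lebesgue \<and> U \<subseteq> \<Omega> \<and>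
            measure lebesgue U / measure lebesgue \<Omega> \<le> 1 / 2 \<longrightarrow>
          (\<exists>N. N \<in> null_sets lebesgue \<and>
             hausdorff_content \<beta> (U - N) \<le> ennreal (C * (1 - \<delta>)) * frac_perimeter \<delta> \<tau> U \<Omega>) \<and>
          (open U \<longrightarrow>
             hausdorff_content \<beta> U \<le> ennreal (C * (1 - \<delta>)) * frac_perimeter \<delta> \<tau> U \<Omega>)"
      using per[THEN spec, THEN mp, OF half] by (elim exE conjE) (rule that)
    have U: "\<forall>U\<in>sets lebesgue. U \<subseteq> \<Omega> \<and> measure lebesgue U / measure lebesgue \<Omega> \<le> 1 / 2 \<longrightarrow>
        (\<exists>N\<in>null_sets lebesgue. hausdorff_content \<beta> (U - N)
          \<le> ennreal (C * (1 - \<delta>)) * frac_perimeter \<delta> \<tau> U \<Omega>)" if "\<delta> \<in> \<Delta>" for \<delta>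
      using level[THEN bspec, OF that] unfolding Bex_def by simp
    obtain K where K: "0 < K" and bound: "\<forall>B\<ge>0. \<forall>\<delta> \<tau> f. set_integrable lebesgue \<Omega> f \<longrightarrow>
      (\<forall>U\<in>sets lebesgue. U \<subseteq> \<Omega> \<and> measure lebesgue U / measure lebesgue \<Omega> \<le> 1 / 2 \<longrightarrow>
        (\<exists>N\<in>null_sets lebesgue. hausdorff_content \<beta> (U - N) \<le> ennreal B * frac_perimeter \<delta> \<tau> U \<Omega>)) \<longrightarrow>
      choquet_integral \<beta> (lebesgue_points \<Omega> f) (\<lambda>x. precise_rep f x - mean_value \<Omega> f)
        \<le> ennreal (K * B) * frac_energy \<delta> \<tau> f \<Omega>"
      using perimeter_bound_imp_choquet_bound[OF \<Omega> \<beta>] by (elim exE conjE) (rule that)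
    show ?choquet
    proof (intro exI[of _ "K * C"] conjI ballI allI impI)
      show "0 < K * C" using K C by simp
      fix \<delta> and f :: "real ^ 'n \<Rightarrow> real" assume \<delta>: "\<delta> \<in> \<Delta>" and f: "set_integrable lebesgue \<Omega> f"
      have "choquet_integral \<beta> (lebesgue_points \<Omega> f) (\<lambda>x. precise_rep f x - mean_value \<Omega> f)
          \<le> ennreal (K * (C * (1 - \<delta>))) * frac_energy \<delta> \<tau> f \<Omega>"
      proof (rule bound[THEN spec, THEN mp, THEN spec, THEN spec, THEN spec, THEN mp, OF _ f, THEN mp])
        show "0 \<le> C * (1 - \<delta>)" using C \<delta>1[OF \<delta>] by simp
      qed (rule U[OF \<delta>])
      then show "choquet_integral \<beta> (lebesgue_points \<Omega> f) (\<lambda>x. precise_rep f x - mean_value \<Omega> f)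
          \<le> ennreal (K * C * (1 - \<delta>)) * frac_energy \<delta> \<tau> f \<Omega>"
        by (simp only: mult.assoc)
    qed
  next
    assume ?choquet
    then obtain C where C: "0 < C" and f: "\<And>\<delta> f. \<delta> \<in> \<Delta> \<Longrightarrow> set_integrable lebesgue \<Omega> f \<Longrightarrow>
        choquet_integral \<beta> (lebesgue_points \<Omega> f) (\<lambda>x. precise_rep f x - mean_value \<Omega> f)
          \<le> ennreal (C * (1 - \<delta>)) * frac_energy \<delta> \<tau> f \<Omega>"
      by blast
    show ?perimeter
    proof (intro allI impI)
      fix \<gamma> :: real assume \<gamma>: "0 < \<gamma> \<and> \<gamma> < 1"
      \<comment> \<open>Dividing by the length \<open>1 - \<gamma>\<close> of the level interval
        makes the constant depend on \<open>\<gamma>\<close> but not on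
        \<open>\<delta>\<close>.\<close>
      let ?C = "C / (1 - \<gamma>)"
      let ?D = "\<lambda>U. {x\<in>U. is_lebesgue_value (indicator U) x 1}"
      have main: "hausdorff_content \<beta> (?D U) \<le> ennreal (?C * (1 - \<delta>)) * frac_perimeter \<delta> \<tau> U \<Omega>"
        if \<delta>: "\<delta> \<in> \<Delta>" and U: "U \<in> sets lebesgue" "U \<subseteq> \<Omega>"
          "measure lebesgue U / measure lebesgue \<Omega> \<le> \<gamma>" for \<delta> U
      proof -
        have "ennreal (1 - \<gamma>) * hausdorff_content \<beta> (?D U)
            \<le> ennreal (C * (1 - \<delta>)) * frac_perimeter \<delta> \<tau> U \<Omega>"
          using content_le_choquet_indicator[OF \<Omega> U, of \<beta>] \<gamma>
            f[OF \<delta> set_integrable_indicator_bounded[OF \<Omega>(2) U(1,2)]]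
          unfolding frac_perimeter_def by (meson order_trans)
        then have "ennreal (1 / (1 - \<gamma>)) * (ennreal (1 - \<gamma>) * hausdorff_content \<beta> (?D U))
            \<le> ennreal (1 / (1 - \<gamma>)) * (ennreal (C * (1 - \<delta>)) * frac_perimeter \<delta> \<tau> U \<Omega>)"
          by (rule mult_left_mono) simp
        moreover have "ennreal (1 / (1 - \<gamma>)) * ennreal (1 - \<gamma>) = 1"
          using \<gamma> by (simp flip: ennreal_mult)
        moreover have "ennreal (1 / (1 - \<gamma>)) * ennreal (C * (1 - \<delta>)) = ennreal (?C * (1 - \<delta>))"
          using \<gamma> C \<delta>1[OF \<delta>] by (simp flip: ennreal_mult)
        ultimately show ?thesis by (simp add: mult.assoc[symmetric])
      qed
      show "\<exists>C>0. \<forall>\<delta>\<in>\<Delta>. \<forall>U. U \<in> sets lebesgue \<and> U \<subseteq> \<Omega> \<and>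
            measure lebesgue U / measure lebesgue \<Omega> \<le> \<gamma> \<longrightarrow>
          (\<exists>N. N \<in> null_sets lebesgue \<and>
             hausdorff_content \<beta> (U - N) \<le> ennreal (C * (1 - \<delta>)) * frac_perimeter \<delta> \<tau> U \<Omega>) \<and>
          (open U \<longrightarrow>
             hausdorff_content \<beta> U \<le> ennreal (C * (1 - \<delta>)) * frac_perimeter \<delta> \<tau> U \<Omega>)"
      proof (intro exI[of _ ?C] conjI ballI allI impI)
        show "0 < ?C" using C \<gamma> by simp
        fix \<delta> U assume \<delta>: "\<delta> \<in> \<Delta>" and U: "U \<in> sets lebesgue \<and> U \<subseteq> \<Omega> \<and>
          measure lebesgue U / measure lebesgue \<Omega> \<le> \<gamma>"
        note le = main[OF \<delta> conjunct1[OF U] conjunct1[OF conjunct2[OF U]] conjunct2[OF conjunct2[OF U]]]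
        show "\<exists>N. N \<in> null_sets lebesgue \<and>
             hausdorff_content \<beta> (U - N) \<le> ennreal (?C * (1 - \<delta>)) * frac_perimeter \<delta> \<tau> U \<Omega>"
        proof (intro exI conjI)
          \<comment> \<open>The exceptional set consists of the points of \<open>U\<close> where
            \<open>U\<close> fails to have density one; it is independent of \<open>\<delta>\<close>
            and empty for open \<open>U\<close>.\<close>
          show "{x\<in>U. \<not> is_lebesgue_value (indicator U) x 1} \<in> null_sets lebesgue"
            using lebesgue_density[OF conjunct1[OF U]] by (simp only: negligible_iff_null_sets)
          have "U - {x\<in>U. \<not> is_lebesgue_value (indicator U) x 1} = ?D U" by blast
          then show "hausdorff_content \<beta> (U - {x\<in>U. \<not> is_lebesgue_value (indicator U) x 1})
              \<le> ennreal (?C * (1 - \<delta>)) * frac_perimeter \<delta> \<tau> U \<Omega>"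
            using le by simp
        qed
        show "hausdorff_content \<beta> U \<le> ennreal (?C * (1 - \<delta>)) * frac_perimeter \<delta> \<tau> U \<Omega>" if "open U"
        proof -
          have "?D U = U" using is_lebesgue_value_indicator_open[OF that] by blast
          then show ?thesis using le by simp
        qed
      qed
    qed
  qed
qed

end
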